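(* There exists an absolute constant $C\ge 1$ ($C=49$ works) such that the following holds. Let $I=[a,b]$ be a compact real interval, let $g$ be a U-shaped function on $I$, and let $G(t)=\int_a^t g(s)\,ds$ for $t\in I$. Let $F\in\mathcal{H}(I)$, and set $Z=F-G$ and $f=U_S(F)$. Then $$\|f-g\|\le \inf_{\pi\in\Pi(I)}\left\{4\,d(g,\mathcal{H}_\pi)+C\sum_{k\in\mathcal{K}^\pi}\ \sup_{t\in[t_{k-1}^\pi,t_k^\pi]}|Z(t)-Z(t_{k-1}^\pi)|\right\}.$$
   Context: A function $g$ on $I=[a,b]$ is U-shaped if there is some $m\in I$ such that $g$ is nonincreasing on $[a,m]$ and nondecreasing on $[m,b]$. $\mathcal{H}(I)$ is the cone of nondecreasing, right-continuous with left-hand limits (cadlag) step functions on $I$. U-shaped regularization: for $F\in\mathcal{H}(I)$ and $m\in I$, $\widetilde F_S^m$ is the function on $I$ defined on $[a,m]$ as the least concave majorant of the restriction of $F$ to $[a,m]$, and on $[m,b]$ as the greatest convex minorant of the restriction of $F$ to $[m,b]$. $U_S^m(F)$ is the right-hand continuous slope (right-hand derivative) of $\widetilde F_S^m$. The mapping $U_S$: let $d_S(m)=\sup_{t\in I}|F(t)-\widetilde F_S^m(t)|$ for $m\in I$. This is a cadlag step function on $I$ whose discontinuity points belong to the set of discontinuity points of $F$. Let $m(F)$ be the midpoint of the interval where $d_S$ achieves its minimum. Then $U_S(F)=U_S^{m(F)}(F)$. Norm and distance: $\|f-g\|=\int_I|f(t)-g(t)|\,dt$ and, for $\mathcal{H}\subset\mathbb{L}_1(I)$,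 $d(f,\mathcal{H})=\inf_{h\in\mathcal{H}}\|f-h\|$. Partitions: $\Pi(I)$ is the set of all finite partitions $\pi=([t_{k-1}^\pi,t_k^\pi))_{k\in\mathcal{K}^\pi}$ of $I$ into intervals, where $a=t_0^\pi<\cdots<t_{D^\pi}^\pi=b$, $\mathcal{K}^\pi=\{1,\dots,D^\pi\}$ and $D^\pi$ is an arbitrary positive integer. $\mathcal{H}_\pi$ is the set of cadlag step functions on $I$ that are constant on every $[t_{k-1}^\pi,t_k^\pi)$, $k\in\mathcal{K}^\pi$. *)

theory Defs
  imports "HOL-Analysis.Analysis"
begin

text \<open>
  Functions on \<open>I = [a,b]\<close> are total functions of type \<^typ>\<open>real \<Rightarrow> real\<close>; every notion below
  depends only on the values taken on \<open>{a..b}\<close>.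
\<close>

definition U_shaped_on :: "real \<Rightarrow> real \<Rightarrow> (real \<Rightarrow> real) \<Rightarrow> bool" where
  "U_shaped_on a b g \<longleftrightarrow> (\<exists>m\<in>{a..b}. antimono_on {a..m} g \<and> mono_on {m..b} g)"

text \<open>A partition is given by its number \<open>D\<close> of intervals and its endpoints \<open>t 0 < \<dots> < t D\<close>;
  the values of \<open>t\<close> beyond \<open>D\<close> play no role.\<close>

definition partitions :: "real \<Rightarrow> real \<Rightarrow> (nat \<times> (nat \<Rightarrow> real)) set" where
  "partitions a b = {(D, t). D \<ge> 1 \<and> t 0 = a \<and> t D = b \<and> strict_mono_on {0..D} t}"

definition step_on :: "real \<Rightarrow> real \<Rightarrow> (real \<Rightarrow> real) \<Rightarrow> bool" where
  "step_on a b f \<longleftrightarrow>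
     (\<exists>(D, t) \<in> partitions a b. \<forall>k\<in>{1..D}. f constant_on {t (k - 1)<..<t k})"

definition cadlag_on :: "real \<Rightarrow> real \<Rightarrow> (real \<Rightarrow> real) \<Rightarrow> bool" where
  "cadlag_on a b f \<longleftrightarrow>
     (\<forall>x\<in>{a..<b}. continuous (at_right x) f) \<and>
     (\<forall>x\<in>{a<..b}. \<exists>l. (f \<longlongrightarrow> l) (at_left x))"

definition H_mono :: "real \<Rightarrow> real \<Rightarrow> (real \<Rightarrow> real) set" where
  "H_mono a b = {F. mono_on {a..b} F \<and> cadlag_on a b F \<and> step_on a b F}"

definition H_part :: "real \<Rightarrow> real \<Rightarrow> nat \<times> (nat \<Rightarrow> real) \<Rightarrow> (real \<Rightarrow> real) set" where
  "H_part a b = (\<lambda>(D, t). {h. cadlag_on a b h \<and> step_on a b h \<and>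
                             (\<forall>k\<in>{1..D}. h constant_on {t (k - 1)..<t k})})"

definition L1_norm :: "real \<Rightarrow> real \<Rightarrow> (real \<Rightarrow> real) \<Rightarrow> real" where
  "L1_norm a b f = (LINT t:{a..b}|lborel. \<bar>f t\<bar>)"

definition L1_dist :: "real \<Rightarrow> real \<Rightarrow> (real \<Rightarrow> real) \<Rightarrow> (real \<Rightarrow> real) set \<Rightarrow> real" where
  "L1_dist a b f H = (INF h\<in>H. L1_norm a b (\<lambda>t. f t - h t))"

definition least_concave_majorant :: "real set \<Rightarrow> (real \<Rightarrow> real) \<Rightarrow> real \<Rightarrow> real" where
  "least_concave_majorant S F t = Inf {h t |h. concave_on S h \<and> (\<forall>x\<in>S. F x \<le> h x)}"

definition greatest_convex_minorant :: "real set \<Rightarrow> (real \<Rightarrow> real) \<Rightarrow> real \<Rightarrow> real" where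
  "greatest_convex_minorant S F t = Sup {h t |h. convex_on S h \<and> (\<forall>x\<in>S. h x \<le> F x)}"

text \<open>For nondecreasing \<open>F\<close> both branches take the value \<open>F m\<close> at \<open>t = m\<close>.\<close>

definition U_regularization ::
    "real \<Rightarrow> real \<Rightarrow> real \<Rightarrow> (real \<Rightarrow> real) \<Rightarrow> real \<Rightarrow> real" where
  "U_regularization a b m F t =
     (if t \<le> m then least_concave_majorant {a..m} F t
      else greatest_convex_minorant {m..b} F t)"

text \<open>The right-hand derivative is the derivative within \<open>{t..b}\<close>. Its value at the single
  point \<open>t = b\<close> is unspecified, which does not affect the \<open>L\<^sup>1\<close> norm.\<close>

definition U_slope :: "real \<Rightarrow> real \<Rightarrow> real \<Rightarrow> (real \<Rightarrow> real) \<Rightarrow> real \<Rightarrow> real" where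
  "U_slope a b m F t = vector_derivative (U_regularization a b m F) (at t within {t..b})"

definition dS :: "real \<Rightarrow> real \<Rightarrow> (real \<Rightarrow> real) \<Rightarrow> real \<Rightarrow> real" where
  "dS a b F m = (SUP t\<in>{a..b}. \<bar>F t - U_regularization a b m F t\<bar>)"

definition dS_argmin :: "real \<Rightarrow> real \<Rightarrow> (real \<Rightarrow> real) \<Rightarrow> real set" where
  "dS_argmin a b F = {m. is_arg_min (dS a b F) (\<lambda>m. m \<in> {a..b}) m}"

text \<open>For \<open>F\<close> in \<^const>\<open>H_mono\<close> the set of minimizers of \<^const>\<open>dS\<close> is a nonempty interval,
  which need not be closed, so its endpoints are taken as infimum and supremum.\<close>

definition m_hat :: "real \<Rightarrow> real \<Rightarrow> (real \<Rightarrow> real) \<Rightarrow> real" where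
  "m_hat a b F = midpoint (Inf (dS_argmin a b F)) (Sup (dS_argmin a b F))"

definition US :: "real \<Rightarrow> real \<Rightarrow> (real \<Rightarrow> real) \<Rightarrow> real \<Rightarrow> real" where
  "US a b F = U_slope a b (m_hat a b F) F"

end

theory Submission
  imports Defs
begin

text \<open>
  Write \<open>M\<close> for the chosen turning point, \<open>m0\<close> for a minimum point of \<open>g\<close>, and \<open>W\<close> for the sum over a
  partition \<open>\<pi>\<close> of the oscillations of \<open>Z = F - G\<close>. For \<open>h\<close> constant on the pieces of \<open>\<pi>\<close> the proof
  yields \<open>\<parallel>f - g\<parallel> \<le> 2 * \<parallel>g - h\<parallel> + 32 * W\<close>.

  The core is the monotone case: \<open>f\<close> is the slope of the least concave majorant \<open>\<Phi>\<close> of \<open>F\<close> and \<open>g\<close>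
  is nonincreasing. Replace \<open>h\<close> by the best approximation of \<open>g\<close> that is constant on the pieces;
  its levels are medians of \<open>g\<close>, hence nonincreasing too. On each piece \<open>f\<close> crosses the level once,
  from above to below, so \<open>\<parallel>f - h\<parallel>\<close> is a sum of increments of \<open>\<Phi>\<close> with signs, and \<open>\<Phi> - G\<close> splits into
  \<open>(\<Phi> - F) + Z\<close>. The part with \<open>Z\<close> is bounded piece by piece by the oscillations. The part with
  \<open>\<Phi> - F \<ge> 0\<close> does not accumulate (\<open>crossing_sum_bound\<close>): \<open>\<Phi>\<close> touches \<open>F\<close> wherever its slope drops
  (\<open>LCM_slope_const_off_contact\<close>), and where the slope is constant the decreasing levels can only
  pass from above \<open>f\<close> to below \<open>f\<close>, which contributes with a negative sign. Only boundary terms remain, at most twice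
  the supremum of \<open>\<Phi> - F\<close>.

  For U-shaped \<open>g\<close>, that supremum is controlled by the choice of \<open>M\<close>: it is at most \<open>dS M \<le> dS m0\<close>,
  and \<open>dS m0 \<le> 2 * W\<close> because \<open>G\<close>, up to an additive constant within \<open>W\<close> of \<open>F\<close>, is concave left of \<open>m0\<close>
  and convex right of it (\<open>dS_le_of_U_shaped\<close>). The minimum of \<open>dS\<close> is attained because \<open>dS\<close> need only
  be inspected at the jump points of \<open>F\<close>, and the midpoint of the set of minimizers is again a
  minimizer because \<open>dS\<close> is quasiconvex (\<open>m_hat_minimizes\<close>). Outside the interval between \<open>m0\<close> and
  \<open>M\<close> both functions are monotone in the same direction, and the monotone case applies, after a change of
  sign on the right. Between \<open>m0\<close> and \<open>M\<close> they are monotone in opposite directions, so \<open>f - g\<close>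
  changes sign once and its norm is bounded by increments of \<open>\<Phi> - G\<close>, hence by a multiple of \<open>W\<close>
  (\<open>opposite_monotone_L1_bound\<close>).

  On the right branch the majorant of \<open>- F\<close> touches left limits of \<open>- F\<close> rather than values, so both
  branches are compared with the upper semicontinuous envelope of the step function.
\<close>

section \<open>Least concave majorants\<close>

lemma concave_on_three_points:
  fixes h :: "real \<Rightarrow> real"
  assumes "concave_on S h" "x \<in> S" "z \<in> S" "x \<le> y" "y \<le> z"
  shows "(z - y) * h x + (y - x) * h z \<le> (z - x) * h y"
proof (cases "x = z")
  case False
  with assms have xz: "x < z" by auto
  define u where "u = (z - y) / (z - x)"
  define v where "v = (y - x) / (z - x)"
  have "u * x + v * z = ((z - y) * x + (y - x) * z) / (z - x)"
    by (simp add: u_def v_def add_divide_distrib)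
  also have "(z - y) * x + (y - x) * z = y * (z - x)" by algebra
  finally have "u * x + v * z = y" using xz by simp
  moreover have "u + v = 1"
    using xz by (simp add: u_def v_def add_divide_distrib[symmetric])
  ultimately have uv: "u \<ge> 0" "v \<ge> 0" "u + v = 1" "u * x + v * z = y"
    using assms xz by (auto simp: u_def v_def)
  have "u * h x + v * h z \<le> h (u *\<^sub>R x + v *\<^sub>R z)"
    using assms uv unfolding concave_on_iff by blast
  hence "u * h x + v * h z \<le> h y" using uv by simp
  hence "(z - x) * (u * h x + v * h z) \<le> (z - x) * h y" using xz by simp
  moreover have "(z - x) * u = z - y" "(z - x) * v = y - x" using xz unfolding u_def v_def by auto
  ultimately show ?thesis by (simp add: distrib_left mult.assoc[symmetric])
qed (use assms in auto)

text \<open>A function lying below a line through each of its points is an infimum of affine functions.\<close>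
lemma concave_on_supporting_lines:
  fixes h k :: "real \<Rightarrow> real"
  assumes "convex S" and line: "\<And>x y. x \<in> S \<Longrightarrow> y \<in> S \<Longrightarrow> h y \<le> h x + k x * (y - x)"
  shows "concave_on S h"
  unfolding concave_on_iff
proof (intro conjI ballI allI impI assms)
  fix x y u v :: real
  assume xy: "x \<in> S" "y \<in> S" "u \<ge> 0" "v \<ge> 0" "u + v = 1"
  define z where "z = u *\<^sub>R x + v *\<^sub>R y"
  have z: "z \<in> S" using assms xy unfolding z_def by (simp add: convex_def)
  have "u * h x + v * h y \<le> u * (h z + k z * (x - z)) + v * (h z + k z * (y - z))"
    using line[OF z] xy by (intro add_mono mult_left_mono) auto
  also have "\<dots> = (u + v) * h z + k z * (u * x + v * y - (u + v) * z)" by algebra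
  also have "\<dots> = h z" using xy by (simp add: z_def)
  finally show "u * h x + v * h y \<le> h (u *\<^sub>R x + v *\<^sub>R y)" by (simp add: z_def)
qed

lemma concave_on_const_interval: "concave_on {p..e::real} (\<lambda>x. c)"
  by (rule concave_on_supporting_lines[where k = "\<lambda>_. 0"]) auto

lemma concave_on_min_affine:
  fixes h :: "real \<Rightarrow> real"
  assumes "concave_on S h"
  shows "concave_on S (\<lambda>x. min (h x) (c + k * (x - q)))"
  unfolding concave_on_iff
proof (intro conjI ballI allI impI)
  show "convex S" using assms concave_on_imp_convex by blast
  fix x y u v :: real
  assume xy: "x \<in> S" "y \<in> S" "u \<ge> 0" "v \<ge> 0" "u + v = 1"
  let ?m = "\<lambda>x. min (h x) (c + k * (x - q))"
  have "u * ?m x + v * ?m y \<le> u * h x + v * h y" using xy by (intro add_mono mult_left_mono) auto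
  moreover have "\<dots> \<le> h (u *\<^sub>R x + v *\<^sub>R y)" using xy assms unfolding concave_on_iff by blast
  moreover have "u * ?m x + v * ?m y \<le> u * (c + k * (x - q)) + v * (c + k * (y - q))"
    using xy by (intro add_mono mult_left_mono) auto
  moreover have "\<dots> = (u + v) * (c - k * q) + k * (u * x + v * y)" by algebra
  moreover have "\<dots> = c + k * (u *\<^sub>R x + v *\<^sub>R y - q)" using xy by (simp add: algebra_simps)
  ultimately show "u * ?m x + v * ?m y \<le> ?m (u *\<^sub>R x + v *\<^sub>R y)" by simp
qed

lemma majorants_nonempty:
  assumes "bdd_above (F ` {p..e})"
  shows "{h t |h. concave_on {p..e} h \<and> (\<forall>x\<in>{p..e::real}. F x \<le> h x)} \<noteq> {}"
proof -
  obtain B where "\<And>x. x \<in> {p..e} \<Longrightarrow> F x \<le> B" using assms unfolding bdd_above_def by blast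
  thus ?thesis using concave_on_const_interval[of p e B] by blast
qed

lemma LCM_greatest:
  assumes "bdd_above (F ` {p..e})"
    and "\<And>h. concave_on {p..e} h \<Longrightarrow> (\<And>x. x \<in> {p..e} \<Longrightarrow> F x \<le> h x) \<Longrightarrow> c \<le> h t"
  shows "c \<le> least_concave_majorant {p..e} F t"
  unfolding least_concave_majorant_def
  by (rule cInf_greatest[OF majorants_nonempty]) (use assms in auto)

lemma LCM_ge:
  "bdd_above (F ` {p..e}) \<Longrightarrow> t \<in> {p..e} \<Longrightarrow> F t \<le> least_concave_majorant {p..e} F t"
  by (rule LCM_greatest) auto

lemma LCM_le:
  assumes "concave_on {p..e} h" "\<And>x. x \<in> {p..e} \<Longrightarrow> F x \<le> h x" "t \<in> {p..e}"
  shows "least_concave_majorant {p..e} F t \<le> h t"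
  unfolding least_concave_majorant_def
  by (rule cInf_lower, use assms in blast, rule bdd_belowI[of _ "F t"], use assms in auto)

lemma concave_on_LCM:
  assumes bdd: "bdd_above (F ` {p..e})"
  shows "concave_on {p..e} (least_concave_majorant {p..e} F)"
  unfolding concave_on_iff
proof (intro conjI ballI allI impI)
  fix x y u v :: real
  assume xy: "x \<in> {p..e}" "y \<in> {p..e}" "u \<ge> 0" "v \<ge> 0" "u + v = 1"
  show "u * least_concave_majorant {p..e} F x + v * least_concave_majorant {p..e} F y
        \<le> least_concave_majorant {p..e} F (u *\<^sub>R x + v *\<^sub>R y)"
  proof (rule LCM_greatest[OF bdd])
    fix h assume h: "concave_on {p..e} h" "\<And>x. x \<in> {p..e} \<Longrightarrow> F x \<le> h x"
    have "u * least_concave_majorant {p..e} F x + v * least_concave_majorant {p..e} F y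
          \<le> u * h x + v * h y"
      using LCM_le[OF h] xy by (intro add_mono mult_left_mono) auto
    also have "\<dots> \<le> h (u *\<^sub>R x + v *\<^sub>R y)" using h xy unfolding concave_on_iff by blast
    finally show "u * least_concave_majorant {p..e} F x + v * least_concave_majorant {p..e} F y
          \<le> h (u *\<^sub>R x + v *\<^sub>R y)" .
  qed
qed simp

lemma LCM_antimono_domain:
  assumes "bdd_above (F ` {p..e})" "p \<le> p'" "e' \<le> e" "t \<in> {p'..e'}"
  shows "least_concave_majorant {p'..e'} F t \<le> least_concave_majorant {p..e} F t"
proof (rule LCM_le)
  show "concave_on {p'..e'} (least_concave_majorant {p..e} F)"
    using concave_on_LCM[OF assms(1)] assms by (auto simp: concave_on_iff)
  show "F x \<le> least_concave_majorant {p..e} F x" if "x \<in> {p'..e'}" for x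
    using that assms by (intro LCM_ge) auto
qed (use assms in auto)

lemma LCM_isCont:
  assumes bdd: "bdd_above (F ` {p..e})" and x: "p < x" "x < e"
  shows "isCont (least_concave_majorant {p..e} F) x"
proof -
  have "concave_on {p<..<e} (least_concave_majorant {p..e} F)"
    using concave_on_LCM[OF bdd] by (auto simp: concave_on_iff)
  hence "continuous_on {p<..<e} (\<lambda>x. - least_concave_majorant {p..e} F x)"
    by (intro convex_on_continuous) (auto simp: concave_on_def)
  hence "continuous_on {p<..<e} (least_concave_majorant {p..e} F)"
    using continuous_on_minus by fastforce
  thus ?thesis using x by (simp add: continuous_on_eq_continuous_at)
qed

text \<open>The principle behind all local information on the majorant: cutting it by a line yields a
  smaller concave function, so minimality forbids every cut that stays above \<open>F\<close>.\<close>
lemma LCM_le_line: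
  assumes bdd: "bdd_above (F ` {p..e})"
    and cut: "\<And>x. x \<in> {p..e} \<Longrightarrow>
      F x \<le> c + k * (x - q) \<or> least_concave_majorant {p..e} F x \<le> c + k * (x - q)"
    and t: "t \<in> {p..e}"
  shows "least_concave_majorant {p..e} F t \<le> c + k * (t - q)"
proof -
  have "F x \<le> min (least_concave_majorant {p..e} F x) (c + k * (x - q))" if "x \<in> {p..e}" for x
    using cut[OF that] LCM_ge[OF bdd that] by auto
  from LCM_le[OF concave_on_min_affine[OF concave_on_LCM[OF bdd]] this t] show ?thesis by simp
qed

text \<open>The cut is along the chord over \<open>[x, y]\<close>: outside this interval a concave function lies
  below the chord, and inside it the chord stays above the level \<open>c\<close>.\<close>
lemma LCM_affine_on_gap:
  assumes bdd: "bdd_above (F ` {p..e})" and xy: "p \<le> x" "x < y" "y \<le> e"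
    and F: "\<And>z. x < z \<Longrightarrow> z < y \<Longrightarrow> F z \<le> c"
    and c: "c \<le> least_concave_majorant {p..e} F x" "c \<le> least_concave_majorant {p..e} F y"
  shows "\<exists>k. \<forall>z\<in>{x..y}.
    least_concave_majorant {p..e} F z = least_concave_majorant {p..e} F x + k * (z - x)"
proof -
  let ?L = "least_concave_majorant {p..e} F"
  define k where "k = (?L y - ?L x) / (y - x)"
  have k: "k * (y - x) = ?L y - ?L x" using xy by (simp add: k_def)
  note three = concave_on_three_points[OF concave_on_LCM[OF bdd]]
  have line: "(y - x) * (?L x + k * (z - x)) = (y - z) * ?L x + (z - x) * ?L y" for z
  proof -
    have "(y - x) * (?L x + k * (z - x)) = (y - x) * ?L x + (k * (y - x)) * (z - x)" by algebra
    also have "\<dots> = (y - z) * ?L x + (z - x) * ?L y" unfolding k by algebra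
    finally show ?thesis .
  qed
  have cut: "F z \<le> ?L x + k * (z - x) \<or> ?L z \<le> ?L x + k * (z - x)" if z: "z \<in> {p..e}" for z
  proof -
    consider "z \<le> x" | "x < z" "z < y" | "y \<le> z" by linarith
    then show ?thesis
    proof cases
      case 1
      have "(y - x) * ?L z \<le> (y - x) * (?L x + k * (z - x))"
        using three[of z y x] z xy 1 unfolding line by (simp add: algebra_simps)
      thus ?thesis using xy by simp
    next
      case 2
      have "(y - x) * c = (y - z) * c + (z - x) * c" by algebra
      also have "\<dots> \<le> (y - x) * (?L x + k * (z - x))"
        unfolding line using c 2 by (intro add_mono mult_left_mono) auto
      finally have "c \<le> ?L x + k * (z - x)" using xy by simp
      thus ?thesis using F[OF 2] by auto
    next
      case 3
      have "(y - x) * ?L z \<le> (y - x) * (?L x + k * (z - x))"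
        using three[of x z y] z xy 3 unfolding line by (simp add: algebra_simps)
      thus ?thesis using xy by simp
    qed
  qed
  have "?L z = ?L x + k * (z - x)" if z: "z \<in> {x..y}" for z
  proof -
    have "?L z \<le> ?L x + k * (z - x)" using z xy by (intro LCM_le_line[OF bdd cut]) auto
    moreover have "(y - x) * (?L x + k * (z - x)) \<le> (y - x) * ?L z"
      using three[of x y z] z xy unfolding line by (simp add: algebra_simps)
    hence "?L x + k * (z - x) \<le> ?L z" using xy by simp
    ultimately show ?thesis by simp
  qed
  thus ?thesis by blast
qed

section \<open>Slopes of least concave majorants of step functions\<close>

text \<open>The local form of being a cadlag step function. Unlike a global subdivision, it is inherited
  by subintervals and by \<open>- F\<close>.\<close>
definition locally_step :: "real \<Rightarrow> real \<Rightarrow> (real \<Rightarrow> real) \<Rightarrow> bool" where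
  "locally_step p e F \<longleftrightarrow>
     (\<forall>x\<in>{p..<e}. \<exists>r>x. r \<le> e \<and> (\<forall>y\<in>{x..<r}. F y = F x)) \<and>
     (\<forall>x\<in>{p<..e}. \<exists>l<x. p \<le> l \<and> (\<exists>v. \<forall>y\<in>{l<..<x}. F y = v))"

text \<open>For majorants of step functions the right derivative exists in the strongest sense: \<open>\<Phi>\<close> is
  affine immediately to the right of each point.\<close>
definition right_slope :: "real \<Rightarrow> real \<Rightarrow> (real \<Rightarrow> real) \<Rightarrow> (real \<Rightarrow> real) \<Rightarrow> bool" where
  "right_slope p e \<Phi> f \<longleftrightarrow>
     (\<forall>x\<in>{p..<e}. \<exists>r>x. r < e \<and> (\<forall>y\<in>{x..r}. \<Phi> y = \<Phi> x + f x * (y - x)))"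

text \<open>The upper semicontinuous envelope of \<open>F\<close>, the left limit being ignored at the left
  endpoint \<open>p\<close>: this is what the majorant touches where its slope drops.\<close>
definition usc_env :: "real \<Rightarrow> (real \<Rightarrow> real) \<Rightarrow> real \<Rightarrow> real" where
  "usc_env p F x = (if x \<le> p then F x else max (F x) (Lim (at_left x) F))"

lemma locally_step_right:
  "locally_step p e F \<Longrightarrow> x \<in> {p..<e} \<Longrightarrow> \<exists>r>x. r \<le> e \<and> (\<forall>y\<in>{x..<r}. F y = F x)"
  unfolding locally_step_def by blast

lemma locally_step_left:
  "locally_step p e F \<Longrightarrow> x \<in> {p<..e} \<Longrightarrow> \<exists>l<x. p \<le> l \<and> (\<exists>v. \<forall>y\<in>{l<..<x}. F y = v)"
  unfolding locally_step_def by blast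

lemma right_slopeD:
  "right_slope p e \<Phi> f \<Longrightarrow> x \<in> {p..<e} \<Longrightarrow>
     \<exists>r>x. r < e \<and> (\<forall>y\<in>{x..r}. \<Phi> y = \<Phi> x + f x * (y - x))"
  unfolding right_slope_def by blast

lemma Lim_at_left_eq:
  assumes "l < (x::real)" "\<And>y. y \<in> {l<..<x} \<Longrightarrow> F y = (v::real)"
  shows "Lim (at_left x) F = v"
proof (rule tendsto_Lim)
  have "eventually (\<lambda>y. F y = v) (at_left x)"
    unfolding eventually_at_left_field using assms by (intro exI[of _ l]) auto
  thus "(F \<longlongrightarrow> v) (at_left x)" by (rule tendsto_eventually)
qed simp

lemma LCM_right_slope_exists:
  assumes bdd: "bdd_above (F ` {p..e})" and step: "locally_step p e F"
  shows "\<exists>f. right_slope p e (least_concave_majorant {p..e} F) f"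
proof -
  let ?L = "least_concave_majorant {p..e} F"
  have "\<exists>k. \<exists>r>x. r < e \<and> (\<forall>y\<in>{x..r}. ?L y = ?L x + k * (y - x))" if x: "x \<in> {p..<e}" for x
  proof -
    obtain r where r: "r > x" "r \<le> e" "\<And>y. y \<in> {x..<r} \<Longrightarrow> F y = F x"
      using locally_step_right[OF step x] by blast
    define r' where "r' = (x + r) / 2"
    have r': "x < r'" "r' < r" using r(1) by (auto simp: r'_def)
    have "\<exists>k. \<forall>z\<in>{x..r'}. ?L z = ?L x + k * (z - x)"
    proof (rule LCM_affine_on_gap[OF bdd])
      show "F x \<le> ?L x" using x by (intro LCM_ge[OF bdd]) auto
      have "F r' \<le> ?L r'" using x r(2) r' by (intro LCM_ge[OF bdd]) auto
      thus "F x \<le> ?L r'" using r(3)[of r'] r' by auto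
      show "F z \<le> F x" if "x < z" "z < r'" for z using r(3)[of z] that r' by auto
    qed (use x r(1,2) r' in auto)
    moreover have "x < r'" "r' < e" using r(2) r' by auto
    ultimately show ?thesis by blast
  qed
  hence "\<forall>x\<in>{p..<e}. \<exists>k. \<exists>r>x. r < e \<and> (\<forall>y\<in>{x..r}. ?L y = ?L x + k * (y - x))" by blast
  from bchoice[OF this] show ?thesis unfolding right_slope_def by blast
qed

text \<open>Chord slopes of a concave function decrease, so the chord over the small affine piece to the
  right of \<open>x\<close>, once extended, lies above the graph.\<close>
lemma concave_right_slope_supporting_line:
  assumes conc: "concave_on {p..e} \<Phi>" and f: "right_slope p e \<Phi> f"
    and x: "x \<in> {p..<e}" and y: "y \<in> {p..e}"
  shows "\<Phi> y \<le> \<Phi> x + f x * (y - x)"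
proof -
  obtain r where r: "r > x" "r < e" "\<And>y. y \<in> {x..r} \<Longrightarrow> \<Phi> y = \<Phi> x + f x * (y - x)"
    using right_slopeD[OF f x] by blast
  have rr: "\<Phi> r = \<Phi> x + f x * (r - x)" using r(1) by (intro r(3)) auto
  consider "y \<le> x" | "y \<in> {x..r}" | "r < y" by force
  then show ?thesis
  proof cases
    case 1
    have "(r - x) * \<Phi> y \<le> (r - y) * \<Phi> x - (x - y) * \<Phi> r"
      using concave_on_three_points[OF conc, of y r x] 1 r(1,2) x y by (simp add: algebra_simps)
    also have "\<dots> = (r - x) * (\<Phi> x + f x * (y - x))" unfolding rr by algebra
    finally show ?thesis using r(1) by simp
  next
    case 3
    have "(r - x) * \<Phi> y \<le> (y - x) * \<Phi> r - (y - r) * \<Phi> x"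
      using concave_on_three_points[OF conc, of x y r] 3 r(1,2) x y by (simp add: algebra_simps)
    also have "\<dots> = (r - x) * (\<Phi> x + f x * (y - x))" unfolding rr by algebra
    finally show ?thesis using r(1) by simp
  next
    case 2
    from r(3)[OF this] show ?thesis by simp
  qed
qed

lemma concave_right_slope_antimono:
  assumes conc: "concave_on {p..e} \<Phi>" and f: "right_slope p e \<Phi> f"
  shows "antimono_on {p..<e} f"
proof (rule monotone_onI)
  fix x y assume xy: "x \<in> {p..<e}" "y \<in> {p..<e}" "x \<le> y"
  note line = concave_right_slope_supporting_line[OF conc f]
  have "\<Phi> y \<le> \<Phi> x + f x * (y - x)" "\<Phi> x \<le> \<Phi> y + f y * (x - y)" using line xy by auto
  hence "(f y - f x) * (y - x) \<le> 0" by (simp add: algebra_simps)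
  thus "f y \<le> f x" using xy by (cases "x = y") (auto simp: mult_le_0_iff)
qed

text \<open>If the majorant stays strictly above the envelope at an interior point, then on a small
  interval around that point \<open>F\<close> stays below a level that the majorant, being continuous, exceeds
  at both ends. So the majorant is affine there.\<close>
lemma LCM_slope_const_off_contact:
  assumes bdd: "bdd_above (F ` {p..e})" and step: "locally_step p e F"
    and f: "right_slope p e (least_concave_majorant {p..e} F) f"
    and x: "p < x" "x < e"
    and gap: "usc_env p F x < least_concave_majorant {p..e} F x"
  shows "\<exists>d>0. \<exists>v. \<forall>y. \<bar>y - x\<bar> < d \<longrightarrow> f y = v"
proof -
  let ?L = "least_concave_majorant {p..e} F"
  let ?E = "usc_env p F x"
  obtain r where r: "r > x" "r \<le> e" "\<And>y. y \<in> {x..<r} \<Longrightarrow> F y = F x"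
    using locally_step_right[OF step, of x] x
    by (metis atLeastLessThan_iff less_imp_le)
  obtain l v where l: "l < x" "p \<le> l" "\<And>y. y \<in> {l<..<x} \<Longrightarrow> F y = v"
    using locally_step_left[OF step, of x] x
    by (metis greaterThanAtMost_iff less_imp_le)
  have E: "?E = max (F x) v" using Lim_at_left_eq[OF l(1,3)] x by (simp add: usc_env_def)
  have "isCont ?L x" using LCM_isCont[OF bdd x] .
  hence "eventually (\<lambda>y. ?L y > ?E) (at x)"
    using gap order_tendstoD(1) unfolding isCont_def by blast
  then obtain d0 where d0: "d0 > 0" "\<And>y. y \<noteq> x \<Longrightarrow> \<bar>y - x\<bar> < d0 \<Longrightarrow> ?L y > ?E"
    unfolding eventually_at by (auto simp: dist_real_def)
  define d where "d = min (d0 / 2) (min ((x - l) / 2) ((r - x) / 2))"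
  have d: "d > 0" "d < d0" "d < x - l" "d < r - x" using d0(1) l(1) r(1) by (auto simp: d_def min_def)
  have "\<exists>k. \<forall>z\<in>{x-d..x+d}. ?L z = ?L (x-d) + k * (z - (x-d))"
  proof (rule LCM_affine_on_gap[OF bdd])
    show "?E \<le> ?L (x-d)" using d0(2)[of "x-d"] d by auto
    show "?E \<le> ?L (x+d)" using d0(2)[of "x+d"] d by auto
    show "F z \<le> ?E" if "x-d < z" "z < x+d" for z
      using l(3)[of z] r(3)[of z] that d unfolding E by (cases "z < x") auto
  qed (use x l(1,2) r(1,2) d in auto)
  then obtain k where k: "\<And>z. z \<in> {x-d..x+d} \<Longrightarrow> ?L z = ?L (x-d) + k * (z - (x-d))"
    by blast
  have "f y = k" if y: "\<bar>y - x\<bar> < d" for y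
  proof -
    have "y \<in> {p..<e}" using y d l(1,2) r(1,2) x by auto
    then obtain s where s: "s > y" "\<And>z. z \<in> {y..s} \<Longrightarrow> ?L z = ?L y + f y * (z - y)"
      using right_slopeD[OF f] by blast
    define z where "z = min s (x + d)"
    have z: "y < z" "z \<le> s" "z \<le> x + d" using s(1) y by (auto simp: z_def)
    have "?L z = ?L y + f y * (z - y)" using z by (intro s(2)) auto
    moreover have "?L z = ?L (x-d) + k * (z - (x-d))" "?L y = ?L (x-d) + k * (y - (x-d))"
      using y z by (auto intro!: k)
    ultimately have "(f y - k) * (z - y) = 0" by (simp add: algebra_simps)
    thus "f y = k" using z by simp
  qed
  thus ?thesis using d by blast
qed

lemma usc_env_ge: "F x \<le> usc_env p F x"
  by (simp add: usc_env_def)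

lemma usc_env_le_LCM:
  assumes bdd: "bdd_above (F ` {p..e})" and step: "locally_step p e F"
    and x: "p \<le> x" "x < e"
  shows "usc_env p F x \<le> least_concave_majorant {p..e} F x"
proof (cases "x = p")
  case True
  thus ?thesis using LCM_ge[OF bdd, of x] x by (simp add: usc_env_def)
next
  case False
  let ?L = "least_concave_majorant {p..e} F"
  have px: "p < x" using x False by simp
  obtain l v where l: "l < x" "p \<le> l" "\<And>y. y \<in> {l<..<x} \<Longrightarrow> F y = v"
    using locally_step_left[OF step, of x] x px
    by (metis greaterThanAtMost_iff less_imp_le)
  have "isCont ?L x" using LCM_isCont[OF bdd px x(2)] .
  hence "(?L \<longlongrightarrow> ?L x) (at_left x)" by (simp add: isCont_def filterlim_at_split)
  moreover have "v \<le> ?L y" if "y \<in> {l<..<x}" for y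
    using LCM_ge[OF bdd, of y] l(3)[OF that] l that x by auto
  hence "eventually (\<lambda>y. v \<le> ?L y) (at_left x)"
    using l by (auto simp: eventually_at_left_field)
  ultimately have "v \<le> ?L x" by (rule tendsto_lowerbound) simp
  thus ?thesis
    using LCM_ge[OF bdd, of x] Lim_at_left_eq[OF l(1,3)] x px by (simp add: usc_env_def)
qed

section \<open>Integrals of monotone functions\<close>

lemma antimono_on_uminus: "antimono_on S f \<Longrightarrow> mono_on S (\<lambda>x. - f x :: real)"
  by (simp add: monotone_on_def)

lemma mono_on_uminus: "mono_on S f \<Longrightarrow> antimono_on S (\<lambda>x. - f x :: real)"
  by (simp add: monotone_on_def)

lemma mono_on_absolutely_integrable:
  fixes f :: "real \<Rightarrow> real"
  assumes "mono_on {s..t} f"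
  shows "f absolutely_integrable_on {s..t}"
  using integrable_mono_on[OF assms] by (simp add: set_integrable_def integrable_restrict_space)

lemma antimono_on_absolutely_integrable:
  fixes f :: "real \<Rightarrow> real"
  assumes "antimono_on {s..t} f"
  shows "f absolutely_integrable_on {s..t}"
  using integrable_mono_on[OF antimono_on_uminus[OF assms]]
  by (simp add: set_integrable_def integrable_restrict_space)

lemma integrable_on_antimono_on:
  fixes f :: "real \<Rightarrow> real"
  shows "antimono_on {s..t} f \<Longrightarrow> f integrable_on {s..t}"
  using antimono_on_absolutely_integrable set_lebesgue_integral_eq_integral(1) by blast

lemma absolutely_integrable_abs_diff:
  fixes f g :: "real \<Rightarrow> real"
  assumes "f absolutely_integrable_on S" "g absolutely_integrable_on S"
  shows "(\<lambda>x. \<bar>f x - g x\<bar>) integrable_on S"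
  using set_integrable_abs[OF set_integral_diff(1)[OF assms]]
  by (rule set_lebesgue_integral_eq_integral(1))

lemma integral_antimono_bounds:
  fixes f :: "real \<Rightarrow> real"
  assumes f: "antimono_on {s..t} f" and st: "s \<le> t"
  shows "f t * (t - s) \<le> integral {s..t} f" "integral {s..t} f \<le> f s * (t - s)"
proof -
  have fx: "f t \<le> f x" "f x \<le> f s" if "x \<in> {s..t}" for x
    using monotone_onD[OF f, of x t] monotone_onD[OF f, of s x] that st by auto
  have "integral {s..t} (\<lambda>_. f t) \<le> integral {s..t} f"
    using integrable_on_antimono_on[OF f] fx by (intro integral_le) auto
  thus "f t * (t - s) \<le> integral {s..t} f" using st by (simp add: mult.commute)
  have "integral {s..t} f \<le> integral {s..t} (\<lambda>_. f s)"
    using integrable_on_antimono_on[OF f] fx by (intro integral_le) auto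
  thus "integral {s..t} f \<le> f s * (t - s)" using st by (simp add: mult.commute)
qed

text \<open>Over a subdivision into \<open>n\<close> equal pieces the increments of \<open>\<Psi>\<close> telescope, and so do
  their bounds, which leaves a total of order \<open>1 / n\<close>.\<close>
lemma eq_if_increments_le_monotone:
  fixes \<Psi> f :: "real \<Rightarrow> real"
  assumes st: "s \<le> t"
    and inc: "\<And>x y. s \<le> x \<Longrightarrow> x \<le> y \<Longrightarrow> y \<le> t \<Longrightarrow> \<bar>\<Psi> y - \<Psi> x\<bar> \<le> (f x - f y) * (y - x)"
  shows "\<Psi> t = \<Psi> s"
proof -
  have bound: "real n * \<bar>\<Psi> t - \<Psi> s\<bar> \<le> (f s - f t) * (t - s)" if n: "n > 0" for n :: nat
  proof -
    define x where "x i = s + real i * ((t - s) / real n)" for i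
    have x0: "x 0 = s" and xn: "x n = t" using n by (auto simp: x_def)
    define w where "w = (t - s) / real n"
    have d: "x (Suc i) - x i = (t - s) / real n" for i
      unfolding x_def w_def[symmetric] by (simp add: algebra_simps)
    have ge: "s \<le> x i" for i using st by (simp add: x_def)
    have le: "x i \<le> t" if "i \<le> n" for i
    proof -
      have "real i * ((t - s) / real n) \<le> real n * ((t - s) / real n)"
        using that st by (intro mult_right_mono) auto
      thus ?thesis using n by (simp add: x_def)
    qed
    have "\<Psi> t - \<Psi> s = (\<Sum>i<n. \<Psi> (x (Suc i)) - \<Psi> (x i))"
      using sum_lessThan_telescope[of "\<lambda>i. \<Psi> (x i)" n] x0 xn by simp
    also have "\<bar>\<dots>\<bar> \<le> (\<Sum>i<n. \<bar>\<Psi> (x (Suc i)) - \<Psi> (x i)\<bar>)" by (rule sum_abs)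
    also have "\<dots> \<le> (\<Sum>i<n. (f (x i) - f (x (Suc i))) * ((t - s) / real n))"
    proof (rule sum_mono)
      fix i assume i: "i \<in> {..<n}"
      have "x i \<le> x (Suc i)" using d[of i] st by (smt (verit) divide_nonneg_nonneg of_nat_0_le_iff)
      thus "\<bar>\<Psi> (x (Suc i)) - \<Psi> (x i)\<bar> \<le> (f (x i) - f (x (Suc i))) * ((t - s) / real n)"
        using inc[of "x i" "x (Suc i)"] ge[of i] le[of "Suc i"] i d[of i] by simp
    qed
    also have "\<dots> = (f s - f t) * ((t - s) / real n)"
      using sum_lessThan_telescope'[of "\<lambda>i. f (x i)" n] x0 xn
      by (simp only: sum_distrib_right[symmetric])
    finally show ?thesis using n by (simp add: field_simps)
  qed
  have "\<not> \<bar>\<Psi> t - \<Psi> s\<bar> > 0"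
  proof
    assume pos: "\<bar>\<Psi> t - \<Psi> s\<bar> > 0"
    obtain n :: nat where n: "(f s - f t) * (t - s) < real n * \<bar>\<Psi> t - \<Psi> s\<bar>"
      using reals_Archimedean3[OF pos] by blast
    have "(f s - f t) * (t - s) < real (Suc n) * \<bar>\<Psi> t - \<Psi> s\<bar>"
      using n pos by (simp add: algebra_simps)
    thus False using bound[of "Suc n"] by simp
  qed
  thus ?thesis by simp
qed

text \<open>A fundamental theorem of calculus for concave functions that presupposes no
  differentiability: supporting lines at both ends of an interval enclose the increment of \<open>\<Phi>\<close>
  between the same bounds as the integral of the slope.\<close>
lemma integral_antimono_eq_increment:
  fixes \<Phi> f :: "real \<Rightarrow> real"
  assumes f: "antimono_on {s..t} f" and st: "s \<le> t"
    and line: "\<And>x y. x \<in> {s..t} \<Longrightarrow> y \<in> {s..t} \<Longrightarrow> \<Phi> y \<le> \<Phi> x + f x * (y - x)"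
  shows "integral {s..t} f = \<Phi> t - \<Phi> s"
proof -
  let ?\<Psi> = "\<lambda>x. \<Phi> x - integral {s..x} f"
  have "?\<Psi> t = ?\<Psi> s"
  proof (rule eq_if_increments_le_monotone[OF st])
    fix x y assume xy: "s \<le> x" "x \<le> y" "y \<le> t"
    have f': "antimono_on {x..y} f" using f xy by (auto simp: monotone_on_def)
    have "integral {s..x} f + integral {x..y} f = integral {s..y} f"
      using xy integrable_on_antimono_on[OF f]
      by (intro Henstock_Kurzweil_Integration.integral_combine integrable_on_subinterval[OF integrable_on_antimono_on[OF f]]) auto
    moreover note integral_antimono_bounds[OF f' xy(2)]
    moreover have "\<Phi> y \<le> \<Phi> x + f x * (y - x)" "\<Phi> x \<le> \<Phi> y + f y * (x - y)"
      using line xy by auto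
    ultimately show "\<bar>?\<Psi> y - ?\<Psi> x\<bar> \<le> (f x - f y) * (y - x)"
      by (auto simp: algebra_simps abs_le_iff)
  qed
  thus ?thesis by simp
qed

lemma integral_abs_sign_change:
  fixes \<phi> :: "real \<Rightarrow> real"
  assumes \<phi>: "\<phi> integrable_on {s..t}" and u: "u \<in> {s..t}"
    and pos: "\<And>x. x \<in> {s..<u} \<Longrightarrow> 0 \<le> \<phi> x" and neg: "\<And>x. x \<in> {u<..t} \<Longrightarrow> \<phi> x \<le> 0"
  shows "(\<lambda>x. \<bar>\<phi> x\<bar>) integrable_on {s..t}"
    and "integral {s..t} (\<lambda>x. \<bar>\<phi> x\<bar>) = integral {s..u} \<phi> - integral {u..t} \<phi>"
proof -
  have int: "\<phi> integrable_on {s..u}" "\<phi> integrable_on {u..t}"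
    using \<phi> u by (auto intro: integrable_on_subinterval)
  have 1: "((\<lambda>x. \<bar>\<phi> x\<bar>) has_integral integral {s..u} \<phi>) {s..u}"
    using integrable_integral[OF int(1)] pos
    by (rule_tac has_integral_spike_finite[of "{u}"]) auto
  have "((\<lambda>x. - \<phi> x) has_integral - integral {u..t} \<phi>) {u..t}"
    using integrable_integral[OF int(2)] by (rule has_integral_neg)
  hence 2: "((\<lambda>x. \<bar>\<phi> x\<bar>) has_integral - integral {u..t} \<phi>) {u..t}"
    using neg by (rule_tac has_integral_spike_finite[of "{u}"]) auto
  have "((\<lambda>x. \<bar>\<phi> x\<bar>) has_integral (integral {s..u} \<phi> + - integral {u..t} \<phi>)) {s..t}"
    using has_integral_combine[OF _ _ 1 2] u by auto
  thus "(\<lambda>x. \<bar>\<phi> x\<bar>) integrable_on {s..t}"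
    "integral {s..t} (\<lambda>x. \<bar>\<phi> x\<bar>) = integral {s..u} \<phi> - integral {u..t} \<phi>"
    by (auto simp: has_integral_iff)
qed

lemma antimono_sign_change:
  fixes \<phi> :: "real \<Rightarrow> real"
  assumes \<phi>: "antimono_on {s..t} \<phi>" and st: "s \<le> t"
  shows "\<exists>u\<in>{s..t}. (\<forall>x\<in>{s..<u}. 0 \<le> \<phi> x) \<and> (\<forall>x\<in>{u<..t}. \<phi> x < 0)"
proof -
  define A where "A = insert s {x \<in> {s..t}. 0 \<le> \<phi> x}"
  define u where "u = Sup A"
  have A: "A \<noteq> {}" "bdd_above A" "A \<subseteq> {s..t}"
    using st by (auto simp: A_def bdd_above_def)
  have us: "s \<le> u" unfolding u_def using A by (intro cSup_upper) (auto simp: A_def)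
  have ut: "u \<le> t" unfolding u_def using A by (intro cSup_least) auto
  have pos: "0 \<le> \<phi> x" if "x \<in> {s..<u}" for x
  proof -
    have "x < Sup A" using that u_def by simp
    then obtain y where y: "y \<in> A" "x < y" using less_cSup_iff[OF A(1,2)] by blast
    hence "y \<in> {s..t}" "0 \<le> \<phi> y" using that by (auto simp: A_def)
    thus ?thesis using \<phi> that y ut unfolding monotone_on_def
      by (smt (verit, best) atLeastAtMost_iff atLeastLessThan_iff)
  qed
  have neg: "\<phi> x < 0" if "x \<in> {u<..t}" for x
  proof (rule ccontr)
    assume "\<not> \<phi> x < 0"
    hence "x \<in> A" using that us by (auto simp: A_def)
    hence "x \<le> u" unfolding u_def using A by (intro cSup_upper) auto
    thus False using that by simp
  qed
  show ?thesis using us ut pos neg by (intro bexI[of _ u]) auto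
qed

lemma le_of_step_le:
  fixes s :: "nat \<Rightarrow> real"
  assumes step: "\<And>k. k < n \<Longrightarrow> s k \<le> s (Suc k)" and "i \<le> j" "j \<le> n"
  shows "s i \<le> s j"
  using assms(2,3)
proof (induction rule: dec_induct)
  case (step k)
  thus ?case using assms(1)[of k] by simp
qed simp

lemma integral_partition_sum:
  fixes s :: "nat \<Rightarrow> real" and \<phi> :: "real \<Rightarrow> real"
  assumes "\<And>k. k < n \<Longrightarrow> s k \<le> s (Suc k)" "\<phi> integrable_on {s 0..s n}"
  shows "integral {s 0..s n} \<phi> = (\<Sum>k<n. integral {s k..s (Suc k)} \<phi>)"
  using assms
proof (induction n)
  case (Suc n)
  have le: "s 0 \<le> s n" using le_of_step_le[of "Suc n" s 0 n] Suc.prems(1) by simp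
  have "s n \<le> s (Suc n)" using Suc.prems(1) by simp
  moreover from this have "\<phi> integrable_on {s 0..s n}"
    using Suc.prems(2) by (rule_tac integrable_on_subinterval) auto
  ultimately show ?case
    using Suc le Henstock_Kurzweil_Integration.integral_combine[of "s 0" "s n" "s (Suc n)" \<phi>] by simp
qed simp

text \<open>The value at the midpoint is a median of a monotone function, and medians are best
  constant approximations in \<open>L\<^sup>1\<close>.\<close>
lemma antimono_midpoint_best_constant:
  fixes g :: "real \<Rightarrow> real"
  assumes g: "antimono_on {s..t} g" and st: "s \<le> t"
  shows "integral {s..t} (\<lambda>x. \<bar>g x - g ((s + t) / 2)\<bar>) \<le> integral {s..t} (\<lambda>x. \<bar>g x - c\<bar>)"
proof -
  define m where "m = (s + t) / 2"
  have m: "m \<in> {s..t}" "m - s = t - m" using st by (auto simp: m_def field_simps)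
  have int: "g integrable_on {s..t}" "g integrable_on {s..m}" "g integrable_on {m..t}"
    using integrable_on_antimono_on[OF g] m by (auto intro: integrable_on_subinterval)
  have abs: "(\<lambda>x. \<bar>g x - c\<bar>) integrable_on {s..t}"
    by (rule absolutely_integrable_abs_diff[OF antimono_on_absolutely_integrable[OF g]]) simp
  have abs': "(\<lambda>x. \<bar>g x - c\<bar>) integrable_on {s..m}" "(\<lambda>x. \<bar>g x - c\<bar>) integrable_on {m..t}"
    using m by (auto intro: integrable_on_subinterval[OF abs])
  have shift: "integral {s..m} (\<lambda>x. g x - d) = integral {s..m} g - d * (m - s)"
    "integral {m..t} (\<lambda>x. g x - d) = integral {m..t} g - d * (m - s)" for d
  proof -
    have "integral {s..m} (\<lambda>x. g x - d) = integral {s..m} g - integral {s..m} (\<lambda>x. d)"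
      using int by (intro Henstock_Kurzweil_Integration.integral_diff) auto
    thus "integral {s..m} (\<lambda>x. g x - d) = integral {s..m} g - d * (m - s)"
      using m by (simp add: mult.commute)
    have "integral {m..t} (\<lambda>x. g x - d) = integral {m..t} g - integral {m..t} (\<lambda>x. d)"
      using int by (intro Henstock_Kurzweil_Integration.integral_diff) auto
    thus "integral {m..t} (\<lambda>x. g x - d) = integral {m..t} g - d * (m - s)"
      using m(1) unfolding m(2) by (simp add: mult.commute)
  qed
  have "integral {s..t} (\<lambda>x. \<bar>g x - g m\<bar>)
      = integral {s..m} (\<lambda>x. g x - g m) - integral {m..t} (\<lambda>x. g x - g m)"
  proof (rule integral_abs_sign_change(2)[OF _ m(1)])
    show "(\<lambda>x. g x - g m) integrable_on {s..t}" using int by (intro integrable_diff) auto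
    show "0 \<le> g x - g m" if "x \<in> {s..<m}" for x
      using monotone_onD[OF g, of x m] m that by auto
    show "g x - g m \<le> 0" if "x \<in> {m<..t}" for x
      using monotone_onD[OF g, of m x] m that by auto
  qed
  also have "\<dots> = integral {s..m} (\<lambda>x. g x - c) + - integral {m..t} (\<lambda>x. g x - c)"
    unfolding shift by simp
  also have "\<dots> \<le> integral {s..m} (\<lambda>x. \<bar>g x - c\<bar>) + integral {m..t} (\<lambda>x. \<bar>g x - c\<bar>)"
  proof (rule add_mono)
    show "integral {s..m} (\<lambda>x. g x - c) \<le> integral {s..m} (\<lambda>x. \<bar>g x - c\<bar>)"
      using int abs' by (intro integral_le integrable_diff) auto
    have "integral {m..t} (\<lambda>x. - (g x - c)) \<le> integral {m..t} (\<lambda>x. \<bar>g x - c\<bar>)"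
      using int abs' by (intro integral_le integrable_neg integrable_diff) auto
    thus "- integral {m..t} (\<lambda>x. g x - c) \<le> integral {m..t} (\<lambda>x. \<bar>g x - c\<bar>)"
      by (simp only: integral_neg)
  qed
  also have "\<dots> = integral {s..t} (\<lambda>x. \<bar>g x - c\<bar>)"
    using m abs by (intro Henstock_Kurzweil_Integration.integral_combine) auto
  finally show ?thesis by (simp add: m_def)
qed

section \<open>Comparison of a majorant slope with a monotone function\<close>

text \<open>On one piece \<open>[s, t]\<close>, \<open>f\<close> crosses the level \<open>h\<close> once, from above to below. Replacing
  \<open>f - h\<close> by \<open>(f - g) + (g - h)\<close> on either side of the crossing point \<open>u\<close> leaves increments of
  \<open>\<Phi> - G\<close>.\<close>
lemma antimono_L1_crossing:
  fixes f g \<Phi> G :: "real \<Rightarrow> real"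
  assumes st: "s \<le> t" and f: "antimono_on {s..t} f" and g: "antimono_on {s..t} g"
    and \<Phi>: "\<And>x y. s \<le> x \<Longrightarrow> x \<le> y \<Longrightarrow> y \<le> t \<Longrightarrow> integral {x..y} f = \<Phi> y - \<Phi> x"
    and G: "\<And>x y. s \<le> x \<Longrightarrow> x \<le> y \<Longrightarrow> y \<le> t \<Longrightarrow> integral {x..y} g = G y - G x"
  shows "\<exists>u\<in>{s..t}. (\<forall>x\<in>{s..<u}. h \<le> f x) \<and> (\<forall>x\<in>{u<..t}. f x < h) \<and>
    integral {s..t} (\<lambda>x. \<bar>f x - g x\<bar>) \<le> 2 * integral {s..t} (\<lambda>x. \<bar>g x - h\<bar>)
      + 2 * (\<Phi> u - G u) - (\<Phi> s - G s) - (\<Phi> t - G t)"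
proof -
  have "antimono_on {s..t} (\<lambda>x. f x - h)" using f by (simp add: monotone_on_def)
  from antimono_sign_change[OF this st] obtain u where u: "u \<in> {s..t}"
    "\<forall>x\<in>{s..<u}. 0 \<le> f x - h" "\<forall>x\<in>{u<..t}. f x - h < 0" by blast
  note fint = integrable_on_antimono_on[OF f] and gint = integrable_on_antimono_on[OF g]
  have fabs: "f absolutely_integrable_on {s..t}" and gabs: "g absolutely_integrable_on {s..t}"
    by (intro antimono_on_absolutely_integrable f g)+
  have int: "(\<lambda>x. \<bar>f x - g x\<bar>) integrable_on {s..t}" "(\<lambda>x. \<bar>f x - h\<bar>) integrable_on {s..t}"
    "(\<lambda>x. \<bar>g x - h\<bar>) integrable_on {s..t}"
    by (intro absolutely_integrable_abs_diff fabs gabs; simp)+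
  have sub: "f integrable_on {s..u}" "f integrable_on {u..t}" "g integrable_on {s..u}"
    "g integrable_on {u..t}" "(\<lambda>x. \<bar>g x - h\<bar>) integrable_on {s..u}"
    "(\<lambda>x. \<bar>g x - h\<bar>) integrable_on {u..t}"
    using u(1) by (auto intro: integrable_on_subinterval[OF fint] integrable_on_subinterval[OF gint]
        integrable_on_subinterval[OF int(3)])
  have eq: "integral I (\<lambda>x. f x - h) = (integral I f - integral I g) + integral I (\<lambda>x. g x - h)"
    if "I = {s..u} \<or> I = {u..t}" for I
  proof -
    have i: "f integrable_on I" "g integrable_on I" "(\<lambda>x. h) integrable_on I" using that sub by auto
    have "integral I (\<lambda>x. f x - h) = integral I (\<lambda>x. (f x - g x) + (g x - h))" by simp
    also have "\<dots> = integral I (\<lambda>x. f x - g x) + integral I (\<lambda>x. g x - h)"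
      using i by (intro Henstock_Kurzweil_Integration.integral_add integrable_diff) auto
    also have "integral I (\<lambda>x. f x - g x) = integral I f - integral I g"
      using i by (intro Henstock_Kurzweil_Integration.integral_diff) auto
    finally show ?thesis .
  qed
  have "integral {s..t} (\<lambda>x. \<bar>f x - g x\<bar>)
      \<le> integral {s..t} (\<lambda>x. \<bar>f x - h\<bar> + \<bar>g x - h\<bar>)"
    using int by (intro integral_le integrable_add) auto
  also have "\<dots> = integral {s..t} (\<lambda>x. \<bar>f x - h\<bar>) + integral {s..t} (\<lambda>x. \<bar>g x - h\<bar>)"
    using int by (intro Henstock_Kurzweil_Integration.integral_add) auto
  also have "integral {s..t} (\<lambda>x. \<bar>f x - h\<bar>)
      = integral {s..u} (\<lambda>x. f x - h) - integral {u..t} (\<lambda>x. f x - h)"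
  proof (rule integral_abs_sign_change(2)[OF _ u(1)])
    show "(\<lambda>x. f x - h) integrable_on {s..t}" using fint by (intro integrable_diff) auto
  qed (use u in \<open>auto intro: less_imp_le\<close>)
  also have "\<dots> = 2 * (\<Phi> u - G u) - (\<Phi> s - G s) - (\<Phi> t - G t)
      + (integral {s..u} (\<lambda>x. g x - h) - integral {u..t} (\<lambda>x. g x - h))"
    using u(1) \<Phi>[of s u] \<Phi>[of u t] G[of s u] G[of u t] by (simp add: eq)
  finally have "integral {s..t} (\<lambda>x. \<bar>f x - g x\<bar>) \<le> 2 * (\<Phi> u - G u) - (\<Phi> s - G s) - (\<Phi> t - G t)
      + (integral {s..u} (\<lambda>x. g x - h) - integral {u..t} (\<lambda>x. g x - h))
      + integral {s..t} (\<lambda>x. \<bar>g x - h\<bar>)" .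
  moreover have "integral {s..u} (\<lambda>x. g x - h) \<le> integral {s..u} (\<lambda>x. \<bar>g x - h\<bar>)"
    using sub by (intro integral_le integrable_diff) auto
  moreover have "integral {u..t} (\<lambda>x. - (g x - h)) \<le> integral {u..t} (\<lambda>x. \<bar>g x - h\<bar>)"
    using sub by (intro integral_le integrable_neg integrable_diff) auto
  hence "- integral {u..t} (\<lambda>x. g x - h) \<le> integral {u..t} (\<lambda>x. \<bar>g x - h\<bar>)"
    by (simp only: integral_neg)
  moreover have "integral {s..u} (\<lambda>x. \<bar>g x - h\<bar>) + integral {u..t} (\<lambda>x. \<bar>g x - h\<bar>)
      = integral {s..t} (\<lambda>x. \<bar>g x - h\<bar>)"
    using u(1) int by (intro Henstock_Kurzweil_Integration.integral_combine) auto
  ultimately have "integral {s..t} (\<lambda>x. \<bar>f x - g x\<bar>) \<le> 2 * integral {s..t} (\<lambda>x. \<bar>g x - h\<bar>)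
      + 2 * (\<Phi> u - G u) - (\<Phi> s - G s) - (\<Phi> t - G t)" by linarith
  moreover have "\<forall>x\<in>{s..<u}. h \<le> f x" "\<forall>x\<in>{u<..t}. f x < h" using u(2,3) by simp_all
  ultimately show ?thesis using u(1) by blast
qed

text \<open>This is what makes the estimate on a whole partition additive in local errors: the distance
  \<open>D = \<Phi> - E\<close> to the envelope enters only through this sum, which does not grow with the number of
  pieces. A crossing point inside a piece is a contact point, where \<open>D\<close> vanishes. A positive multiple
  of \<open>D\<close> at a partition point comes from \<open>f\<close> being above its level all along the piece before it;
  as the levels decrease, \<open>f\<close> is then below the next level from the start only if it drops there, which
  makes this a contact point too. Otherwise the next term of the sum cancels it.\<close>
lemma crossing_sum_bound:
  fixes s u h :: "nat \<Rightarrow> real" and D f :: "real \<Rightarrow> real"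
  assumes s: "\<And>k. k < n \<Longrightarrow> s k \<le> s (Suc k)"
    and h: "\<And>k. Suc k < n \<Longrightarrow> h (Suc k) \<le> h k"
    and u: "\<And>k. k < n \<Longrightarrow> u k \<in> {s k..s (Suc k)}"
    and above: "\<And>k x. k < n \<Longrightarrow> x \<in> {s k..<u k} \<Longrightarrow> h k \<le> f x"
    and below: "\<And>k x. k < n \<Longrightarrow> x \<in> {u k<..s (Suc k)} \<Longrightarrow> f x < h k"
    and D: "\<And>x. x \<in> {s 0..s n} \<Longrightarrow> 0 \<le> D x" "\<And>x. x \<in> {s 0..s n} \<Longrightarrow> D x \<le> \<eta>"
    and contact: "\<And>x. s 0 < x \<Longrightarrow> x < s n \<Longrightarrow> 0 < D x \<Longrightarrow>
      \<exists>d>0. \<exists>v. \<forall>y. \<bar>y - x\<bar> < d \<longrightarrow> f y = v"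
  shows "(\<Sum>k<n. 2 * D (u k) - D (s k) - D (s (Suc k))) \<le> 2 * \<eta>"
proof -
  let ?S = "\<lambda>m. \<Sum>k<m. 2 * D (u k) - D (s k) - D (s (Suc k))"
  have mem: "s k \<in> {s 0..s n}" if "k \<le> n" for k
    using le_of_step_le[of n s 0 k, OF s] le_of_step_le[of n s k n, OF s] that by auto
  \<comment> \<open>a drop of \<open>f\<close> across a level occurs at a contact point\<close>
  have drop: "D x = 0"
    if x: "s 0 < x" "x < s n" and q: "q < x" "x < r"
      and ab: "\<And>y. y \<in> {q<..<x} \<Longrightarrow> c \<le> f y" "\<And>y. y \<in> {x<..<r} \<Longrightarrow> f y < c" for x q r c
  proof (rule ccontr)
    assume "D x \<noteq> 0"
    hence "0 < D x" using D(1)[of x] x by simp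
    then obtain d v where d: "d > 0" "\<And>y. \<bar>y - x\<bar> < d \<Longrightarrow> f y = v" using contact x by blast
    define e where "e = min (d / 2) (min ((x - q) / 2) ((r - x) / 2))"
    have e: "e > 0" "e < d" "e < x - q" "e < r - x" using d(1) q by (auto simp: e_def min_def)
    have "c \<le> f (x - e)" "f (x + e) < c" using e by (auto intro!: ab)
    moreover have "f (x - e) = v" "f (x + e) = v" using e by (auto intro!: d(2))
    ultimately show False by simp
  qed
  have "m \<le> n \<Longrightarrow> ?S m + D (s m) \<le> \<eta> \<or>
      (?S m - D (s m) \<le> \<eta> \<and> (\<exists>j q. m = Suc j \<and> s 0 \<le> q \<and> q < s m \<and> (\<forall>x\<in>{q<..<s m}. h j \<le> f x)))"
    for m
  proof (induction m)
    case 0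
    thus ?case using D(2)[of "s 0"] mem[of 0] by simp
  next
    case (Suc m)
    let ?inv = "\<lambda>m. ?S m - D (s m) \<le> \<eta> \<and>
      (\<exists>j q. m = Suc j \<and> s 0 \<le> q \<and> q < s m \<and> (\<forall>x\<in>{q<..<s m}. h j \<le> f x))"
    have m: "m < n" using Suc.prems by simp
    note IH = Suc.IH[OF less_imp_le[OF m]]
    have Dm: "0 \<le> D (s m)" "0 \<le> D (s (Suc m))" using mem[of m] mem[of "Suc m"] m D(1) by auto
    have SSuc: "?S (Suc m) = ?S m + (2 * D (u m) - D (s m) - D (s (Suc m)))" by simp
    have um: "s m \<le> u m" "u m \<le> s (Suc m)" using u[OF m] by auto
    have low: "s 0 \<le> s m" "s (Suc m) \<le> s n" using mem[of m] mem[of "Suc m"] m by auto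
    have weak: "?S m - D (s m) \<le> \<eta>" using IH Dm by auto
    consider "s m = s (Suc m)" | "s m < u m" "u m < s (Suc m)" | "s m < u m" "u m = s (Suc m)"
      | "u m = s m" "s m < s (Suc m)" using um by linarith
    then show ?case
    proof cases
      case 1
      hence S: "?S (Suc m) = ?S m" using um by (simp add: SSuc del: sum.lessThan_Suc)
      show ?thesis
      proof (cases "?S m + D (s m) \<le> \<eta>")
        case True
        thus ?thesis using S 1 by simp
      next
        case False
        then obtain j q where jq: "m = Suc j" "s 0 \<le> q" "q < s m" "\<forall>x\<in>{q<..<s m}. h j \<le> f x"
          using IH by blast
        have "h m \<le> h j" using h[of j] jq(1) m by simp
        hence "\<forall>x\<in>{q<..<s (Suc m)}. h m \<le> f x" using jq(4) 1 by force
        moreover have "?S (Suc m) - D (s (Suc m)) \<le> \<eta>" using weak S 1 by simp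
        ultimately show ?thesis using jq(2,3) 1
          by (intro disjI2 conjI exI[of _ m] exI[of _ q]) auto
      qed
    next
      case 2
      have "D (u m) = 0"
        using 2 low above[OF m] below[OF m]
        by (intro drop[where q = "s m" and r = "s (Suc m)" and c = "h m"]) auto
      thus ?thesis using weak SSuc by auto
    next
      case 3
      have "?S (Suc m) - D (s (Suc m)) \<le> \<eta>" using weak SSuc 3 by simp
      moreover have "\<forall>x\<in>{s m<..<s (Suc m)}. h m \<le> f x" using above[OF m] 3 by auto
      ultimately show ?thesis using 3 low
        by (intro disjI2 conjI exI[of _ m] exI[of _ "s m"]) auto
    next
      case 4
      have "?S m + D (s m) \<le> \<eta>"
      proof (cases "?S m + D (s m) \<le> \<eta>")
        case False
        then obtain j q where jq: "m = Suc j" "s 0 \<le> q" "q < s m" "\<forall>x\<in>{q<..<s m}. h j \<le> f x"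
          using IH by blast
        have "h m \<le> h j" using h[of j] jq(1) m by simp
        hence "h m \<le> f y" if "y \<in> {q<..<s m}" for y using jq(4) that by force
        moreover have "f y < h m" if "y \<in> {s m<..<s (Suc m)}" for y
          using below[OF m, of y] 4 that by auto
        ultimately have "D (s m) = 0"
          using 4 low jq(2,3) by (intro drop[where q = q and r = "s (Suc m)" and c = "h m"]) auto
        thus ?thesis using weak by simp
      qed
      thus ?thesis using SSuc 4 by simp
    qed
  qed
  from this[of n] have "?S n \<le> \<eta> + D (s n)" using D(1)[OF mem[of n]] by auto
  thus ?thesis using D(2)[OF mem[of n]] by simp
qed

text \<open>Writing \<open>\<Phi> - G\<close> as \<open>(\<Phi> - E) + (E - G)\<close> in the crossing estimate of each piece separates the
  distance to the envelope, which sums up to at most \<open>2 * \<eta>\<close>, from the local oscillation \<open>v k\<close> of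
  the noise \<open>E - G\<close>.\<close>
lemma antimono_L1_bound:
  fixes s \<theta> v :: "nat \<Rightarrow> real" and f g \<Phi> G E :: "real \<Rightarrow> real"
  assumes s: "\<And>k. k < n \<Longrightarrow> s k \<le> s (Suc k)"
    and f: "antimono_on {s 0..s n} f" and g: "antimono_on {s 0..s n} g"
    and \<Phi>: "\<And>x y. s 0 \<le> x \<Longrightarrow> x \<le> y \<Longrightarrow> y \<le> s n \<Longrightarrow> integral {x..y} f = \<Phi> y - \<Phi> x"
    and G: "\<And>x y. s 0 \<le> x \<Longrightarrow> x \<le> y \<Longrightarrow> y \<le> s n \<Longrightarrow> integral {x..y} g = G y - G x"
    and E: "\<And>x. x \<in> {s 0..s n} \<Longrightarrow> E x \<le> \<Phi> x" "\<And>x. x \<in> {s 0..s n} \<Longrightarrow> \<Phi> x - E x \<le> \<eta>"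
    and contact: "\<And>x. s 0 < x \<Longrightarrow> x < s n \<Longrightarrow> E x < \<Phi> x \<Longrightarrow>
      \<exists>d>0. \<exists>v. \<forall>y. \<bar>y - x\<bar> < d \<longrightarrow> f y = v"
    and v: "\<And>k u. k < n \<Longrightarrow> u \<in> {s k..s (Suc k)} \<Longrightarrow>
      2 * (E u - G u) - (E (s k) - G (s k)) - (E (s (Suc k)) - G (s (Suc k))) \<le> v k"
  shows "integral {s 0..s n} (\<lambda>x. \<bar>f x - g x\<bar>)
    \<le> 2 * (\<Sum>k<n. integral {s k..s (Suc k)} (\<lambda>x. \<bar>g x - \<theta> k\<bar>)) + (\<Sum>k<n. v k) + 2 * \<eta>"
proof -
  \<comment> \<open>midpoint values keep the levels nonincreasing and approximate \<open>g\<close> at least as well as \<open>\<theta>\<close>\<close>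
  define h where "h k = g ((s k + s (Suc k)) / 2)" for k
  have mem: "s k \<in> {s 0..s n}" if "k \<le> n" for k
    using le_of_step_le[of n s 0 k, OF s] le_of_step_le[of n s k n, OF s] that by auto
  have sub: "{s k..s (Suc k)} \<subseteq> {s 0..s n}" if "k < n" for k
    using mem[of k] mem[of "Suc k"] that by auto
  let ?P = "\<lambda>k u. u \<in> {s k..s (Suc k)} \<and> (\<forall>x\<in>{s k..<u}. h k \<le> f x) \<and>
    (\<forall>x\<in>{u<..s (Suc k)}. f x < h k) \<and>
    integral {s k..s (Suc k)} (\<lambda>x. \<bar>f x - g x\<bar>)
      \<le> 2 * integral {s k..s (Suc k)} (\<lambda>x. \<bar>g x - h k\<bar>)
        + 2 * (\<Phi> u - G u) - (\<Phi> (s k) - G (s k)) - (\<Phi> (s (Suc k)) - G (s (Suc k)))"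
  have "\<exists>u\<in>{s k..s (Suc k)}. (\<forall>x\<in>{s k..<u}. h k \<le> f x) \<and> (\<forall>x\<in>{u<..s (Suc k)}. f x < h k) \<and>
    integral {s k..s (Suc k)} (\<lambda>x. \<bar>f x - g x\<bar>)
      \<le> 2 * integral {s k..s (Suc k)} (\<lambda>x. \<bar>g x - h k\<bar>)
        + 2 * (\<Phi> u - G u) - (\<Phi> (s k) - G (s k)) - (\<Phi> (s (Suc k)) - G (s (Suc k)))"
    if k: "k \<in> {..<n}" for k
  proof (rule antimono_L1_crossing)
    show "antimono_on {s k..s (Suc k)} f" "antimono_on {s k..s (Suc k)} g"
      using f g sub[of k] k by (auto intro: monotone_on_subset)
    show "s k \<le> s (Suc k)" using s k by simp
    have low: "s 0 \<le> s k" "s (Suc k) \<le> s n" using mem[of k] mem[of "Suc k"] k by auto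
    show "integral {x..y} f = \<Phi> y - \<Phi> x" if "s k \<le> x" "x \<le> y" "y \<le> s (Suc k)" for x y
      using \<Phi>[of x y] low that by linarith
    show "integral {x..y} g = G y - G x" if "s k \<le> x" "x \<le> y" "y \<le> s (Suc k)" for x y
      using G[of x y] low that by linarith
  qed
  hence "\<forall>k\<in>{..<n}. \<exists>u. ?P k u" by blast
  from bchoice[OF this] obtain u where "\<forall>k\<in>{..<n}. ?P k (u k)" by blast
  hence u: "\<And>k. k < n \<Longrightarrow> u k \<in> {s k..s (Suc k)}"
    "\<And>k x. k < n \<Longrightarrow> x \<in> {s k..<u k} \<Longrightarrow> h k \<le> f x"
    "\<And>k x. k < n \<Longrightarrow> x \<in> {u k<..s (Suc k)} \<Longrightarrow> f x < h k"
    "\<And>k. k < n \<Longrightarrow> integral {s k..s (Suc k)} (\<lambda>x. \<bar>f x - g x\<bar>)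
      \<le> 2 * integral {s k..s (Suc k)} (\<lambda>x. \<bar>g x - h k\<bar>)
        + 2 * (\<Phi> (u k) - G (u k)) - (\<Phi> (s k) - G (s k)) - (\<Phi> (s (Suc k)) - G (s (Suc k)))"
    unfolding lessThan_iff Ball_def by blast+
  define D where "D x = \<Phi> x - E x" for x
  have D_sum: "(\<Sum>k<n. 2 * D (u k) - D (s k) - D (s (Suc k))) \<le> 2 * \<eta>"
  proof (rule crossing_sum_bound[where f = f and h = h and D = D and s = s and u = u])
    fix k assume k: "Suc k < n"
    have "s k \<le> s (Suc k)" "s (Suc k) \<le> s (Suc (Suc k))" using s[of k] s[of "Suc k"] k by auto
    moreover have "s 0 \<le> s k" "s (Suc (Suc k)) \<le> s n"
      using mem[of k] mem[of "Suc (Suc k)"] k by auto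
    ultimately show "h (Suc k) \<le> h k"
      unfolding h_def by (intro monotone_onD[OF g]) auto
  next
    show "0 \<le> D x" "D x \<le> \<eta>" if "x \<in> {s 0..s n}" for x using E[OF that] by (auto simp: D_def)
    show "\<exists>d>0. \<exists>v. \<forall>y. \<bar>y - x\<bar> < d \<longrightarrow> f y = v" if "s 0 < x" "x < s n" "0 < D x" for x
      using contact[of x] that by (simp add: D_def)
  qed (fact s u)+
  have "integral {s 0..s n} (\<lambda>x. \<bar>f x - g x\<bar>)
      = (\<Sum>k<n. integral {s k..s (Suc k)} (\<lambda>x. \<bar>f x - g x\<bar>))"
    using s absolutely_integrable_abs_diff[OF antimono_on_absolutely_integrable[OF f]
        antimono_on_absolutely_integrable[OF g]]
    by (rule integral_partition_sum)
  also have "\<dots> \<le> (\<Sum>k<n. 2 * integral {s k..s (Suc k)} (\<lambda>x. \<bar>g x - \<theta> k\<bar>) + v k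
      + (2 * D (u k) - D (s k) - D (s (Suc k))))"
  proof (rule sum_mono)
    fix k assume "k \<in> {..<n}"
    hence k: "k < n" by simp
    have "antimono_on {s k..s (Suc k)} g" using g sub[OF k] by (rule monotone_on_subset)
    hence "integral {s k..s (Suc k)} (\<lambda>x. \<bar>g x - h k\<bar>)
        \<le> integral {s k..s (Suc k)} (\<lambda>x. \<bar>g x - \<theta> k\<bar>)"
      unfolding h_def using s[OF k] by (rule antimono_midpoint_best_constant)
    thus "integral {s k..s (Suc k)} (\<lambda>x. \<bar>f x - g x\<bar>)
        \<le> 2 * integral {s k..s (Suc k)} (\<lambda>x. \<bar>g x - \<theta> k\<bar>) + v k
          + (2 * D (u k) - D (s k) - D (s (Suc k)))"
      using u(4)[OF k] v[OF k u(1)[OF k]] unfolding D_def by (simp add: algebra_simps)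
  qed
  also have "\<dots> = 2 * (\<Sum>k<n. integral {s k..s (Suc k)} (\<lambda>x. \<bar>g x - \<theta> k\<bar>)) + (\<Sum>k<n. v k)
      + (\<Sum>k<n. 2 * D (u k) - D (s k) - D (s (Suc k)))"
    by (simp only: sum.distrib sum_distrib_left)
  finally show ?thesis using D_sum by linarith
qed

text \<open>Where \<open>f\<close> and \<open>g\<close> are monotone in opposite directions, \<open>f - g\<close> itself changes sign once.\<close>
lemma opposite_monotone_L1_bound:
  fixes f g \<Phi> G :: "real \<Rightarrow> real"
  assumes st: "s \<le> t" and f: "antimono_on {s..t} f" and g: "mono_on {s..t} g"
    and \<Phi>: "\<And>x y. s \<le> x \<Longrightarrow> x \<le> y \<Longrightarrow> y \<le> t \<Longrightarrow> integral {x..y} f = \<Phi> y - \<Phi> x"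
    and G: "\<And>x y. s \<le> x \<Longrightarrow> x \<le> y \<Longrightarrow> y \<le> t \<Longrightarrow> integral {x..y} g = G y - G x"
    and K: "\<And>x. x \<in> {s..t} \<Longrightarrow> \<bar>\<Phi> x - G x - z\<bar> \<le> K"
  shows "integral {s..t} (\<lambda>x. \<bar>f x - g x\<bar>) \<le> 4 * K"
proof -
  have fint: "f integrable_on {s..t}" and gint: "g integrable_on {s..t}"
    using f g by (auto intro: integrable_on_antimono_on integrable_on_mono_on)
  have "antimono_on {s..t} (\<lambda>x. f x - g x)"
    using f g unfolding monotone_on_def by (meson diff_mono)
  from antimono_sign_change[OF this st] obtain u where u: "u \<in> {s..t}"
    "\<forall>x\<in>{s..<u}. 0 \<le> f x - g x" "\<forall>x\<in>{u<..t}. f x - g x < 0" by blast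
  have eq: "integral I (\<lambda>x. f x - g x) = integral I f - integral I g"
    if "I = {s..u} \<or> I = {u..t}" for I
    using that u(1) fint gint
    by (intro Henstock_Kurzweil_Integration.integral_diff)
      (auto intro: integrable_on_subinterval)
  have "integral {s..t} (\<lambda>x. \<bar>f x - g x\<bar>)
      = integral {s..u} (\<lambda>x. f x - g x) - integral {u..t} (\<lambda>x. f x - g x)"
  proof (rule integral_abs_sign_change(2)[OF _ u(1)])
    show "(\<lambda>x. f x - g x) integrable_on {s..t}" using fint gint by (rule integrable_diff)
  qed (use u in \<open>auto intro: less_imp_le\<close>)
  also have "\<dots> = 2 * (\<Phi> u - G u - z) - (\<Phi> s - G s - z) - (\<Phi> t - G t - z)"
    using u(1) \<Phi>[of s u] \<Phi>[of u t] G[of s u] G[of u t] by (simp add: eq)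
  also have "\<dots> \<le> 4 * K" using K[of u] K[of s] K[of t] u(1) by (auto simp: abs_le_iff)
  finally show ?thesis .
qed

lemma LCM_slope_facts:
  assumes bdd: "bdd_above (F ` {p..e})"
    and f: "right_slope p e (least_concave_majorant {p..e} F) f"
  shows "antimono_on {p..<e} f"
    and "p \<le> x \<Longrightarrow> x \<le> y \<Longrightarrow> y < e \<Longrightarrow>
      integral {x..y} f = least_concave_majorant {p..e} F y - least_concave_majorant {p..e} F x"
proof -
  show mono: "antimono_on {p..<e} f"
    by (rule concave_right_slope_antimono[OF concave_on_LCM[OF bdd] f])
  assume xy: "p \<le> x" "x \<le> y" "y < e"
  show "integral {x..y} f = least_concave_majorant {p..e} F y - least_concave_majorant {p..e} F x"
  proof (rule integral_antimono_eq_increment[OF _ xy(2)])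
    show "antimono_on {x..y} f" using mono by (rule monotone_on_subset) (use xy in auto)
    show "least_concave_majorant {p..e} F v \<le> least_concave_majorant {p..e} F u + f u * (v - u)"
      if "u \<in> {x..y}" "v \<in> {x..y}" for u v
      using that xy by (intro concave_right_slope_supporting_line[OF concave_on_LCM[OF bdd] f]) auto
  qed
qed

text \<open>Closeness of \<open>F - G\<close> to a constant on a piece passes to the envelope, whose values are
  values or left limits of \<open>F\<close>. The left end of the piece is excluded, because the left limit there
  belongs to the preceding piece.\<close>
lemma usc_env_near:
  assumes step: "locally_step p e F" and G: "continuous_on {p..e} G"
    and near: "\<And>y. y \<in> {s..x} \<Longrightarrow> y \<in> {p..x} \<Longrightarrow> \<bar>F y - G y - z\<bar> \<le> \<omega>"
    and x: "s < x" "p \<le> x" "x \<le> e"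
  shows "\<bar>usc_env p F x - G x - z\<bar> \<le> \<omega>"
proof (cases "x = p")
  case True
  thus ?thesis using near[of x] x by (simp add: usc_env_def)
next
  case False
  hence px: "p < x" using x by simp
  obtain l v where l: "l < x" "p \<le> l" "\<And>y. y \<in> {l<..<x} \<Longrightarrow> F y = v"
    using locally_step_left[OF step, of x] x px by (metis greaterThanAtMost_iff)
  have "continuous (at x within {p..e}) G"
    using G x by (simp add: continuous_on_eq_continuous_within)
  hence "(G \<longlongrightarrow> G x) (at x within {p..x})"
    unfolding continuous_within by (rule tendsto_within_subset) (use x in auto)
  hence "(G \<longlongrightarrow> G x) (at_left x)"
    by (simp only: at_within_Icc_at_left[OF px])
  hence lim: "((\<lambda>y. \<bar>v - G y - z\<bar>) \<longlongrightarrow> \<bar>v - G x - z\<bar>) (at_left x)" by (intro tendsto_intros)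
  have "\<bar>v - G y - z\<bar> \<le> \<omega>" if "max l s < y" "y < x" for y
    using near[of y] l(3)[of y] l(1,2) that by auto
  hence "eventually (\<lambda>y. \<bar>v - G y - z\<bar> \<le> \<omega>) (at_left x)"
    unfolding eventually_at_left_field using l(1) x by (intro exI[of _ "max l s"]) auto
  with lim have "\<bar>v - G x - z\<bar> \<le> \<omega>" by (rule tendsto_upperbound) simp
  moreover have "\<bar>F x - G x - z\<bar> \<le> \<omega>" using near[of x] x by auto
  ultimately show ?thesis
    using Lim_at_left_eq[OF l(1,3)] px by (auto simp: usc_env_def max_def)
qed

lemma sum_shift_le:
  fixes w :: "nat \<Rightarrow> real"
  assumes "\<And>k. k < n \<Longrightarrow> 0 \<le> w k"
  shows "(\<Sum>k<n. if k = 0 then 0 else w (k - 1)) \<le> (\<Sum>k<n. w k)"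
proof (cases n)
  case (Suc m)
  have "(\<Sum>k<Suc m. if k = 0 then 0 else w (k - 1)) = (\<Sum>k<m. w k)"
    by (subst sum.lessThan_Suc_shift) simp
  thus ?thesis using assms[of m] Suc by simp
qed simp

text \<open>Clamping restricts a partition to \<open>{x..c}\<close> without renumbering: the pieces outside shrink to
  points.\<close>
lemma clamped_partition:
  fixes t :: "nat \<Rightarrow> real" and x c :: real
  defines "s \<equiv> \<lambda>k. max x (min c (t k))"
  assumes t: "\<forall>k<n. t k < t (Suc k)" and ends: "t 0 \<le> x" "x \<le> c" "c \<le> t n"
  shows "k < n \<Longrightarrow> s k \<le> s (Suc k)" "s 0 = x" "s n = c"
    and "s k < s (Suc k) \<Longrightarrow> t k \<le> s k \<and> s (Suc k) \<le> t (Suc k) \<and> x \<le> s k \<and> s (Suc k) \<le> c"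
  using ends t by (auto simp: s_def max_def min_def split: if_splits)

lemma sum_integral_pieces:
  fixes t \<theta> :: "nat \<Rightarrow> real" and g h :: "real \<Rightarrow> real" and x c :: real
  assumes t: "\<And>k. k < n \<Longrightarrow> t k < t (Suc k)" and ends: "t 0 \<le> x" "x \<le> c" "c \<le> t n"
    and h: "\<And>k y. k < n \<Longrightarrow> y \<in> {t k..<t (Suc k)} \<Longrightarrow> h y = \<theta> k"
    and int: "(\<lambda>y. \<bar>g y - h y\<bar>) integrable_on {x..c}"
  shows "(\<Sum>k<n. integral {max x (min c (t k))..max x (min c (t (Suc k)))} (\<lambda>y. \<bar>g y - \<theta> k\<bar>))
    = integral {x..c} (\<lambda>y. \<bar>g y - h y\<bar>)"
proof -
  define s where "s k = max x (min c (t k))" for k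
  have tn: "\<forall>k<n. t k < t (Suc k)" using t by blast
  note cp = clamped_partition[OF tn ends, folded s_def]
  have "integral {s k..s (Suc k)} (\<lambda>y. \<bar>g y - \<theta> k\<bar>) = integral {s k..s (Suc k)} (\<lambda>y. \<bar>g y - h y\<bar>)"
    if k: "k < n" for k
  proof (cases "s k = s (Suc k)")
    case False
    hence "s k < s (Suc k)" using cp(1)[OF k] by simp
    hence "{s k..<s (Suc k)} \<subseteq> {t k..<t (Suc k)}" using cp(4)[of k] by auto
    hence "\<bar>g y - \<theta> k\<bar> = \<bar>g y - h y\<bar>" if "y \<in> {s k..s (Suc k)} - {s (Suc k)}" for y
      using h[OF k, of y] that by auto
    thus ?thesis by (intro integral_spike[of "{s (Suc k)}"]) auto
  qed simp
  hence "(\<Sum>k<n. integral {s k..s (Suc k)} (\<lambda>y. \<bar>g y - \<theta> k\<bar>))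
      = (\<Sum>k<n. integral {s k..s (Suc k)} (\<lambda>y. \<bar>g y - h y\<bar>))" by simp
  also have "\<dots> = integral {s 0..s n} (\<lambda>y. \<bar>g y - h y\<bar>)"
    using cp(1) int by (intro integral_partition_sum[symmetric]) (simp_all add: cp(2,3))
  finally show ?thesis unfolding cp(2,3) unfolding s_def .
qed

text \<open>On the piece number \<open>k\<close> the envelope error involves \<open>\<omega> k\<close> four times; when the piece starts
  at a partition point, the left limit there adds twice the oscillation on the preceding piece.\<close>
lemma LCM_slope_L1_bound:
  fixes t z \<omega> \<theta> :: "nat \<Rightarrow> real" and F G f g h :: "real \<Rightarrow> real"
  assumes bdd: "bdd_above (F ` {p..e})" and step: "locally_step p e F"
    and f: "right_slope p e (least_concave_majorant {p..e} F) f"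
    and xc: "p \<le> x" "x \<le> c" "c < e"
    and t: "\<And>k. k < n \<Longrightarrow> t k < t (Suc k)" "t 0 \<le> p" "e \<le> t n"
    and Gcont: "continuous_on {p..e} G"
    and near: "\<And>k y. k < n \<Longrightarrow> y \<in> {t k..t (Suc k)} \<Longrightarrow> y \<in> {p..e} \<Longrightarrow> \<bar>F y - G y - z k\<bar> \<le> \<omega> k"
    and z: "\<And>k. Suc k < n \<Longrightarrow> \<bar>z (Suc k) - z k\<bar> \<le> \<omega> k"
    and \<omega>: "\<And>k. k < n \<Longrightarrow> 0 \<le> \<omega> k"
    and \<eta>: "\<And>y. y \<in> {x..c} \<Longrightarrow> least_concave_majorant {p..e} F y - F y \<le> \<eta>"
    and g: "antimono_on {x..c} g"
    and G: "\<And>u v. x \<le> u \<Longrightarrow> u \<le> v \<Longrightarrow> v \<le> c \<Longrightarrow> integral {u..v} g = G v - G u"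
    and h: "\<And>k y. k < n \<Longrightarrow> y \<in> {t k..<t (Suc k)} \<Longrightarrow> h y = \<theta> k"
    and int: "(\<lambda>y. \<bar>g y - h y\<bar>) integrable_on {x..c}"
  shows "integral {x..c} (\<lambda>y. \<bar>f y - g y\<bar>)
    \<le> 2 * integral {x..c} (\<lambda>y. \<bar>g y - h y\<bar>) + 6 * (\<Sum>k<n. \<omega> k) + 2 * \<eta>"
proof -
  let ?L = "least_concave_majorant {p..e} F" and ?E = "usc_env p F"
  define s where "s k = max x (min c (t k))" for k
  define \<omega>' where "\<omega>' k = (if k = 0 then 0 else \<omega> (k - 1))" for k
  have ends: "t 0 \<le> x" "x \<le> c" "c \<le> t n" using t xc by auto
  have tn: "\<forall>k<n. t k < t (Suc k)" using t(1) by blast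
  note cp = clamped_partition[OF tn ends, folded s_def]
  have \<omega>': "0 \<le> \<omega>' k" if "k < n" for k using \<omega>[of "k - 1"] that by (simp add: \<omega>'_def)
  have E1: "\<bar>?E y - G y - z k\<bar> \<le> \<omega> k" if "k < n" "t k < y" "y \<le> t (Suc k)" "x \<le> y" "y \<le> c" for k y
  proof (rule usc_env_near[OF step Gcont])
    show "\<bar>F w - G w - z k\<bar> \<le> \<omega> k" if "w \<in> {t k..y}" "w \<in> {p..y}" for w
      using near[OF \<open>k < n\<close>, of w] that \<open>y \<le> t (Suc k)\<close> \<open>y \<le> c\<close> xc by auto
  qed (use that xc in auto)
  have E2: "\<bar>?E y - G y - z k\<bar> \<le> \<omega> k + 2 * \<omega>' k"
    if k: "k < n" and y: "t k \<le> y" "y \<le> t (Suc k)" "x \<le> y" "y \<le> c" for k y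
  proof (cases "t k = y")
    case False
    thus ?thesis using E1[of k y] k y \<omega>'[OF k] by auto
  next
    case True
    show ?thesis
    proof (cases k)
      case 0
      hence "y = p" using True t(2) xc y by auto
      hence "?E y = F y" by (simp add: usc_env_def)
      thus ?thesis using near[OF k, of y] y xc \<omega>'[OF k] by auto
    next
      case (Suc j)
      have "\<bar>?E y - G y - z j\<bar> \<le> \<omega> j" using E1[of j y] t(1)[of j] True Suc k y by auto
      moreover have "\<bar>z k - z j\<bar> \<le> \<omega> j" using z[of j] Suc k by simp
      ultimately show ?thesis using \<omega>[OF k] Suc by (simp add: \<omega>'_def)
    qed
  qed
  have "integral {s 0..s n} (\<lambda>y. \<bar>f y - g y\<bar>)
    \<le> 2 * (\<Sum>k<n. integral {s k..s (Suc k)} (\<lambda>y. \<bar>g y - \<theta> k\<bar>)) + (\<Sum>k<n. 4 * \<omega> k + 2 * \<omega>' k) + 2 * \<eta>"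
  proof (rule antimono_L1_bound[where \<Phi> = ?L and G = G and E = ?E])
    show "s k \<le> s (Suc k)" if "k < n" for k using cp(1) that .
    show "antimono_on {s 0..s n} f" unfolding cp(2,3)
      by (rule monotone_on_subset[OF LCM_slope_facts(1)[OF bdd f]]) (use xc in auto)
    show "antimono_on {s 0..s n} g" unfolding cp(2,3) by (rule g)
    show "integral {u..v} f = ?L v - ?L u" if "s 0 \<le> u" "u \<le> v" "v \<le> s n" for u v
      using that xc unfolding cp(2,3) by (intro LCM_slope_facts(2)[OF bdd f]) auto
    show "integral {u..v} g = G v - G u" if "s 0 \<le> u" "u \<le> v" "v \<le> s n" for u v
      using that unfolding cp(2,3) by (rule G)
    show "?E y \<le> ?L y" if "y \<in> {s 0..s n}" for y
      using that xc unfolding cp(2,3) by (intro usc_env_le_LCM[OF bdd step]) auto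
    show "?L y - ?E y \<le> \<eta>" if "y \<in> {s 0..s n}" for y
      using that \<eta>[of y] usc_env_ge[of F y p] unfolding cp(2,3) by simp
    show "\<exists>d>0. \<exists>v. \<forall>w. \<bar>w - y\<bar> < d \<longrightarrow> f w = v" if "s 0 < y" "y < s n" "?E y < ?L y" for y
      using that xc unfolding cp(2,3) by (intro LCM_slope_const_off_contact[OF bdd step f]) auto
    show "2 * (?E u - G u) - (?E (s k) - G (s k)) - (?E (s (Suc k)) - G (s (Suc k)))
        \<le> 4 * \<omega> k + 2 * \<omega>' k" if k: "k < n" and u: "u \<in> {s k..s (Suc k)}" for k u
    proof (cases "s k = s (Suc k)")
      case True
      hence "u = s k" "u = s (Suc k)" using u by auto
      thus ?thesis using \<omega>[OF k] \<omega>'[OF k] by simp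
    next
      case False
      hence sk: "s k < s (Suc k)" using cp(1)[OF k] by simp
      note c4 = cp(4)[OF sk]
      have e1: "\<bar>?E (s k) - G (s k) - z k\<bar> \<le> \<omega> k + 2 * \<omega>' k" using c4 sk k by (intro E2) auto
      have e2: "\<bar>?E (s (Suc k)) - G (s (Suc k)) - z k\<bar> \<le> \<omega> k" using c4 sk k by (intro E1) auto
      show ?thesis
      proof (cases "u = s k")
        case True
        thus ?thesis using e1 e2 \<omega>[OF k] \<omega>'[OF k] unfolding abs_le_iff by simp
      next
        case False
        hence "\<bar>?E u - G u - z k\<bar> \<le> \<omega> k" using c4 sk k u by (intro E1) auto
        thus ?thesis using e1 e2 unfolding abs_le_iff by simp
      qed
    qed
  qed
  moreover have "(\<Sum>k<n. 4 * \<omega> k + 2 * \<omega>' k) \<le> 6 * (\<Sum>k<n. \<omega> k)"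
    using sum_shift_le[of n \<omega>, OF \<omega>] by (simp add: sum.distrib sum_distrib_left[symmetric] \<omega>'_def)
  moreover have "(\<Sum>k<n. integral {s k..s (Suc k)} (\<lambda>y. \<bar>g y - \<theta> k\<bar>)) = integral {x..c} (\<lambda>y. \<bar>g y - h y\<bar>)"
    unfolding s_def by (rule sum_integral_pieces[OF t(1) ends h int])
  ultimately show ?thesis unfolding cp(2,3) by linarith
qed

section \<open>The choice of the turning point\<close>

lemma greatest_convex_minorant_eq:
  "greatest_convex_minorant S F t = - least_concave_majorant S (\<lambda>x. - F x) t"
proof -
  have "{h t |h. convex_on S h \<and> (\<forall>x\<in>S. h x \<le> F x)}
      = uminus ` {h t |h. concave_on S h \<and> (\<forall>x\<in>S. - F x \<le> h x)}" (is "?A = uminus ` ?B")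
  proof (intro equalityI subsetI)
    fix y assume "y \<in> ?A"
    then obtain h where h: "y = h t" "convex_on S h" "\<forall>x\<in>S. h x \<le> F x" by blast
    hence "- h t \<in> ?B" by (intro CollectI exI[of _ "\<lambda>x. - h x"]) (auto simp: concave_on_def)
    thus "y \<in> uminus ` ?B" using h(1) by force
  next
    fix y assume "y \<in> uminus ` ?B"
    then obtain h where h: "y = - h t" "concave_on S h" "\<forall>x\<in>S. - F x \<le> h x" by blast
    hence "\<forall>x\<in>S. - h x \<le> F x" by force
    thus "y \<in> ?A" using h by (intro CollectI exI[of _ "\<lambda>x. - h x"]) (auto simp: concave_on_def)
  qed
  thus ?thesis
    unfolding greatest_convex_minorant_def least_concave_majorant_def by (simp add: Inf_real_def)
qed

lemma U_regularization_eq: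
  "U_regularization a b m F t = (if t \<le> m then least_concave_majorant {a..m} F t
     else - least_concave_majorant {m..b} (\<lambda>x. - F x) t)"
  by (simp add: U_regularization_def greatest_convex_minorant_eq)

lemma mono_on_bdd_above:
  fixes F :: "real \<Rightarrow> real"
  assumes F: "mono_on {a..b} F" and sub: "{p..e} \<subseteq> {a..b}"
  shows "bdd_above (F ` {p..e})" "bdd_above ((\<lambda>x. - F x) ` {p..e})"
proof -
  have bound: "F x \<le> F b" "- F x \<le> - F a" if "x \<in> {p..e}" for x
  proof -
    have "a \<le> x" "x \<le> b" using that sub by auto
    thus "F x \<le> F b" "- F x \<le> - F a"
      using monotone_onD[OF F, of x b] monotone_onD[OF F, of a x] by auto
  qed
  show "bdd_above (F ` {p..e})" using bound(1) by (rule bdd_aboveI2)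
  show "bdd_above ((\<lambda>x. - F x) ` {p..e})" using bound(2) by (rule bdd_aboveI2)
qed

lemma integral_antimono_concave:
  fixes g G :: "real \<Rightarrow> real"
  assumes g: "antimono_on {s..t} g"
    and G: "\<And>x y. s \<le> x \<Longrightarrow> x \<le> y \<Longrightarrow> y \<le> t \<Longrightarrow> integral {x..y} g = G y - G x"
  shows "concave_on {s..t} (\<lambda>x. G x + c)"
proof (rule concave_on_supporting_lines[where k = g])
  fix x y assume xy: "x \<in> {s..t}" "y \<in> {s..t}"
  show "G y + c \<le> G x + c + g x * (y - x)"
  proof (cases "x \<le> y")
    case True
    have "antimono_on {x..y} g" using g by (rule monotone_on_subset) (use xy in auto)
    from integral_antimono_bounds(2)[OF this True] show ?thesis using G[of x y] xy True by auto
  next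
    case False
    hence yx: "y \<le> x" by simp
    have "antimono_on {y..x} g" using g by (rule monotone_on_subset) (use xy in auto)
    from integral_antimono_bounds(1)[OF this yx] show ?thesis
      using G[of y x] xy yx by (simp add: algebra_simps)
  qed
qed simp

context
  fixes a b :: real and F :: "real \<Rightarrow> real"
  assumes ab: "a < b" and F: "mono_on {a..b} F"
begin

lemma U_regularization_error_left:
  assumes "t \<in> {a..b}" "m \<in> {a..b}" "t \<le> m"
  shows "\<bar>F t - U_regularization a b m F t\<bar> = least_concave_majorant {a..m} F t - F t"
proof -
  have "{a..m} \<subseteq> {a..b}" using assms by auto
  from LCM_ge[OF mono_on_bdd_above(1)[OF F this], of t] show ?thesis
    using assms by (simp add: U_regularization_eq)
qed

lemma U_regularization_error_right:
  assumes "t \<in> {a..b}" "m \<in> {a..b}" "m < t"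
  shows "\<bar>F t - U_regularization a b m F t\<bar> = least_concave_majorant {m..b} (\<lambda>x. - F x) t + F t"
proof -
  have "{m..b} \<subseteq> {a..b}" using assms by auto
  from LCM_ge[OF mono_on_bdd_above(2)[OF F this], of t] show ?thesis
    using assms by (simp add: U_regularization_eq)
qed

lemma U_regularization_error_le:
  assumes "t \<in> {a..b}" "m \<in> {a..b}"
  shows "\<bar>F t - U_regularization a b m F t\<bar> \<le> F b - F a"
proof (cases "t \<le> m")
  case True
  have "least_concave_majorant {a..m} F t \<le> F b"
    by (rule LCM_le[OF concave_on_const_interval])
      (use assms True monotone_onD[OF F, of _ b] in auto)
  thus ?thesis
    using U_regularization_error_left[OF assms True] monotone_onD[OF F, of a t] assms by simp
next
  case False
  have "least_concave_majorant {m..b} (\<lambda>x. - F x) t \<le> - F a"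
    by (rule LCM_le[OF concave_on_const_interval])
      (use assms False monotone_onD[OF F, of a] in auto)
  thus ?thesis
    using U_regularization_error_right[OF assms] False monotone_onD[OF F, of t b] assms by simp
qed

lemma U_regularization_error_le_dS:
  assumes "t \<in> {a..b}" "m \<in> {a..b}"
  shows "\<bar>F t - U_regularization a b m F t\<bar> \<le> dS a b F m"
  unfolding dS_def using U_regularization_error_le assms
  by (intro cSUP_upper bdd_aboveI2[where M = "F b - F a"]) auto

lemma dS_leI:
  assumes "\<And>t. t \<in> {a..b} \<Longrightarrow> \<bar>F t - U_regularization a b m F t\<bar> \<le> c"
  shows "dS a b F m \<le> c"
  unfolding dS_def using assms ab by (intro cSUP_least) auto

text \<open>Moving the turning point to the right increases the error on the left branch and decreases
  it on the right branch, so the maximum of the two is quasiconvex.\<close>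
lemma dS_quasiconvex:
  assumes m: "m1 \<in> {a..b}" "m2 \<in> {a..b}" "m1 \<le> m" "m \<le> m2"
  shows "dS a b F m \<le> max (dS a b F m1) (dS a b F m2)"
proof (rule dS_leI)
  fix t assume t: "t \<in> {a..b}"
  have m': "m \<in> {a..b}" using m by auto
  show "\<bar>F t - U_regularization a b m F t\<bar> \<le> max (dS a b F m1) (dS a b F m2)"
  proof (cases "t \<le> m")
    case True
    hence "\<bar>F t - U_regularization a b m F t\<bar> \<le> \<bar>F t - U_regularization a b m2 F t\<bar>"
      using U_regularization_error_left[OF t m' True] U_regularization_error_left[OF t m(2)]
        LCM_antimono_domain[OF mono_on_bdd_above(1)[OF F], of a m2 a m t] m t by simp
    thus ?thesis using U_regularization_error_le_dS[OF t m(2)] by simp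
  next
    case False
    hence "\<bar>F t - U_regularization a b m F t\<bar> \<le> \<bar>F t - U_regularization a b m1 F t\<bar>"
      using U_regularization_error_right[OF t m'] U_regularization_error_right[OF t m(1)]
        LCM_antimono_domain[OF mono_on_bdd_above(2)[OF F], of m1 b m b t] m t by simp
    thus ?thesis using U_regularization_error_le_dS[OF t m(1)] by simp
  qed
qed

text \<open>While \<open>F\<close> is constant, moving the turning point to the left loses nothing on the right
  branch: a concave majorant of \<open>- F\<close> on \<open>{m..b}\<close>, cut at the level \<open>- F m\<close>, still majorizes
  \<open>- F\<close>, attains its maximum at \<open>m\<close>, and therefore extends to the left by a constant.\<close>
lemma LCM_extend_left:
  assumes pm: "a \<le> p" "p \<le> m" "m \<le> b" and const: "\<And>x. x \<in> {p..m} \<Longrightarrow> F x = c"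
    and t: "t \<in> {m..b}"
  shows "least_concave_majorant {p..b} (\<lambda>x. - F x) t \<le> least_concave_majorant {m..b} (\<lambda>x. - F x) t"
proof (rule LCM_greatest)
  show "bdd_above ((\<lambda>x. - F x) ` {m..b})" using pm by (intro mono_on_bdd_above(2)[OF F]) auto
  fix h assume h: "concave_on {m..b} h" "\<And>x. x \<in> {m..b} \<Longrightarrow> - F x \<le> h x"
  define v where "v x = min (h x) (- c)" for x
  have "concave_on {m..b} (\<lambda>x. min (h x) (- c + 0 * (x - 0)))" by (rule concave_on_min_affine[OF h(1)])
  hence v: "concave_on {m..b} v" by (simp add: v_def[abs_def])
  have Fm: "F m = c" using const pm by simp
  have vm: "v m = - c" using h(2)[of m] Fm pm by (simp add: v_def)
  have v_le: "v x \<le> v m" for x unfolding vm by (simp add: v_def)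
  have anti: "v y \<le> v x" if "m \<le> x" "x \<le> y" "y \<le> b" for x y
  proof (cases "y = m")
    case False
    have "(y - m) * v y = (y - x) * v y + (x - m) * v y" by algebra
    also have "\<dots> \<le> (y - x) * v m + (x - m) * v y"
      using v_le that by (intro add_right_mono mult_left_mono) auto
    also have "\<dots> \<le> (y - m) * v x"
      by (rule concave_on_three_points[OF v]) (use that pm in auto)
    finally show ?thesis using False that by simp
  qed (use that in auto)
  define w where "w x = v (max x m)" for x
  have "concave_on {p..b} w"
    unfolding concave_on_iff
  proof (intro conjI ballI allI impI)
    fix x y \<alpha> \<beta> :: real
    assume xy: "x \<in> {p..b}" "y \<in> {p..b}" "\<alpha> \<ge> 0" "\<beta> \<ge> 0" "\<alpha> + \<beta> = 1"
    let ?z = "\<alpha> * max x m + \<beta> * max y m"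
    have "\<alpha> * x + \<beta> * y \<le> ?z" "\<alpha> * m + \<beta> * m \<le> ?z"
      using xy by (intro add_mono mult_left_mono; simp)+
    moreover have "\<alpha> * m + \<beta> * m = m" using xy(5) by (simp add: distrib_right[symmetric])
    moreover have "?z \<le> \<alpha> * b + \<beta> * b" using xy pm by (intro add_mono mult_left_mono) auto
    moreover have "\<alpha> * b + \<beta> * b = b" using xy(5) by (simp add: distrib_right[symmetric])
    ultimately have z: "max (\<alpha> * x + \<beta> * y) m \<le> ?z" "?z \<le> b" by auto
    have "\<alpha> * w x + \<beta> * w y \<le> v (\<alpha> *\<^sub>R max x m + \<beta> *\<^sub>R max y m)"
      using v xy pm unfolding concave_on_iff w_def by auto
    also have "\<dots> \<le> w (\<alpha> *\<^sub>R x + \<beta> *\<^sub>R y)"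
      unfolding w_def using z by (auto intro!: anti)
    finally show "\<alpha> * w x + \<beta> * w y \<le> w (\<alpha> *\<^sub>R x + \<beta> *\<^sub>R y)" .
  qed simp
  moreover have "- F x \<le> w x" if x: "x \<in> {p..b}" for x
  proof (cases "x \<le> m")
    case True
    thus ?thesis using x const[of x] vm by (simp add: w_def max_def)
  next
    case False
    thus ?thesis using x h(2)[of x] monotone_onD[OF F, of m x] pm Fm by (simp add: w_def v_def)
  qed
  ultimately have "least_concave_majorant {p..b} (\<lambda>x. - F x) t \<le> w t"
    using t pm by (intro LCM_le) auto
  also have "\<dots> \<le> h t" using t by (simp add: w_def v_def)
  finally show "least_concave_majorant {p..b} (\<lambda>x. - F x) t \<le> h t" .
qed

lemma dS_const_piece:
  assumes pm: "a \<le> p" "p \<le> m" "m \<le> b" and const: "\<And>x. x \<in> {p..m} \<Longrightarrow> F x = c"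
  shows "dS a b F p \<le> dS a b F m"
proof (rule dS_leI)
  fix t assume t: "t \<in> {a..b}"
  have p: "p \<in> {a..b}" and m: "m \<in> {a..b}" using pm by auto
  consider "t \<le> p" | "p < t" "t \<le> m" | "m < t" by linarith
  then show "\<bar>F t - U_regularization a b p F t\<bar> \<le> dS a b F m"
  proof cases
    case 1
    hence "\<bar>F t - U_regularization a b p F t\<bar> \<le> \<bar>F t - U_regularization a b m F t\<bar>"
      using U_regularization_error_left[OF t p 1] U_regularization_error_left[OF t m]
        LCM_antimono_domain[OF mono_on_bdd_above(1)[OF F], of a m a p t] pm t by simp
    thus ?thesis using U_regularization_error_le_dS[OF t m] by simp
  next
    case 2
    have "F p = c" using const pm by simp
    hence "least_concave_majorant {p..b} (\<lambda>x. - F x) t \<le> - c"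
      using 2 t pm monotone_onD[OF F, of p]
      by (intro LCM_le[OF concave_on_const_interval]) auto
    moreover have "F t = c" using const 2 by simp
    ultimately have "\<bar>F t - U_regularization a b p F t\<bar> \<le> 0"
      using U_regularization_error_right[OF t p 2(1)] by simp
    also have "0 \<le> dS a b F m" using U_regularization_error_le_dS[OF t m] by simp
    finally show ?thesis .
  next
    case 3
    hence "\<bar>F t - U_regularization a b p F t\<bar> \<le> \<bar>F t - U_regularization a b m F t\<bar>"
      using U_regularization_error_right[OF t p] U_regularization_error_right[OF t m 3]
        LCM_extend_left[OF pm const, of t] pm t by simp
    thus ?thesis using U_regularization_error_le_dS[OF t m] by simp
  qed
qed

text \<open>Marshall's argument: a concave function within \<open>W\<close> of \<open>F\<close>, raised by \<open>W\<close>, majorizes \<open>F\<close>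
  and hence its least concave majorant.\<close>
lemma dS_le_of_U_shaped:
  assumes m: "m \<in> {a..b}" and g: "antimono_on {a..m} g" "mono_on {m..b} g"
    and G: "\<And>x y. a \<le> x \<Longrightarrow> x \<le> y \<Longrightarrow> y \<le> b \<Longrightarrow> integral {x..y} g = G y - G x"
    and W: "\<And>x. x \<in> {a..b} \<Longrightarrow> \<bar>F x - G x - z\<bar> \<le> W"
  shows "dS a b F m \<le> 2 * W"
proof (rule dS_leI)
  fix t assume t: "t \<in> {a..b}"
  show "\<bar>F t - U_regularization a b m F t\<bar> \<le> 2 * W"
  proof (cases "t \<le> m")
    case True
    have "least_concave_majorant {a..m} F t \<le> G t + (z + W)"
    proof (rule LCM_le)
      show "concave_on {a..m} (\<lambda>x. G x + (z + W))"
        using G m by (intro integral_antimono_concave[OF g(1)]) auto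
      show "F x \<le> G x + (z + W)" if "x \<in> {a..m}" for x
        using W[of x] that m by (auto simp: abs_le_iff)
    qed (use t True in auto)
    thus ?thesis using U_regularization_error_left[OF t m True] W[OF t] by (simp add: abs_le_iff)
  next
    case False
    have "least_concave_majorant {m..b} (\<lambda>x. - F x) t \<le> - G t + (W - z)"
    proof (rule LCM_le)
      show "concave_on {m..b} (\<lambda>x. - G x + (W - z))"
        using G m by (intro integral_antimono_concave[OF mono_on_uminus[OF g(2)]]) auto
      show "- F x \<le> - G x + (W - z)" if "x \<in> {m..b}" for x
        using W[of x] that m by (auto simp: abs_le_iff)
    qed (use t False in auto)
    thus ?thesis using U_regularization_error_right[OF t m] False W[OF t] by (simp add: abs_le_iff)
  qed
qed

end

lemma partition_find_right:
  fixes t :: "nat \<Rightarrow> real"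
  assumes "t 0 \<le> x" "x < t n"
  shows "\<exists>k<n. t k \<le> x \<and> x < t (Suc k)"
  using assms(2)
proof (induction n)
  case (Suc n)
  show ?case
  proof (cases "x < t n")
    case True
    thus ?thesis using Suc.IH less_SucI by blast
  next
    case False
    thus ?thesis using Suc.prems by (intro exI[of _ n]) auto
  qed
qed (use assms(1) in simp)

lemma partition_find_left:
  fixes t :: "nat \<Rightarrow> real"
  assumes "t 0 < x" "x \<le> t n"
  shows "\<exists>k<n. t k < x \<and> x \<le> t (Suc k)"
  using assms(2)
proof (induction n)
  case (Suc n)
  show ?case
  proof (cases "x \<le> t n")
    case True
    thus ?thesis using Suc.IH less_SucI by blast
  next
    case False
    thus ?thesis using Suc.prems by (intro exI[of _ n]) auto
  qed
qed (use assms(1) in simp)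

lemma partitionsD:
  assumes "(D, t) \<in> partitions a b"
  shows "D \<ge> 1" "t 0 = a" "t D = b" "k < D \<Longrightarrow> t k < t (Suc k)"
  using assms unfolding partitions_def by (auto simp: monotone_on_def)

text \<open>Right continuity extends the constancy of a step function on an open piece to the left end
  of that piece.\<close>
lemma H_mono_pieces:
  assumes "F \<in> H_mono a b"
  shows "\<exists>D t. (D, t) \<in> partitions a b \<and> (\<forall>k<D. \<forall>x\<in>{t k..<t (Suc k)}. F x = F (t k))"
proof -
  have cad: "cadlag_on a b F" and "step_on a b F" using assms by (auto simp: H_mono_def)
  then obtain D t where Dt: "(D, t) \<in> partitions a b"
    and *: "\<forall>k\<in>{1..D}. F constant_on {t (k - 1)<..<t k}" unfolding step_on_def by blast
  hence const: "F constant_on {t k<..<t (Suc k)}" if "k < D" for k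
    using bspec[OF *, of "Suc k"] that by simp
  note P = partitionsD[OF Dt]
  have "F x = F (t k)" if k: "k < D" and x: "x \<in> {t k..<t (Suc k)}" for k x
  proof (cases "x = t k")
    case False
    obtain v where v: "\<And>y. y \<in> {t k<..<t (Suc k)} \<Longrightarrow> F y = v"
      using const[OF k] unfolding constant_on_def by blast
    have "t 0 \<le> t k" "t (Suc k) \<le> t D"
      using le_of_step_le[of D t 0 k] le_of_step_le[of D t "Suc k" D] P(4) k by (auto simp: less_imp_le)
    hence "t k \<in> {a..<b}" using P(2,3) P(4)[OF k] by auto
    hence "(F \<longlongrightarrow> F (t k)) (at_right (t k))"
      using cad unfolding cadlag_on_def continuous_within by blast
    moreover have "eventually (\<lambda>y. F y = v) (at_right (t k))"
      unfolding eventually_at_right_field using P(4)[OF k] v by (intro exI[of _ "t (Suc k)"]) auto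
    hence "(F \<longlongrightarrow> v) (at_right (t k))" by (rule tendsto_eventually)
    ultimately have "F (t k) = v" using tendsto_unique trivial_limit_at_right_real by blast
    thus ?thesis using v[of x] x False by auto
  qed simp
  thus ?thesis using Dt by blast
qed

lemma H_mono_locally_step:
  assumes "F \<in> H_mono a b" "a \<le> p" "e \<le> b"
  shows "locally_step p e F"
proof -
  obtain D t where Dt: "(D, t) \<in> partitions a b"
    and F: "\<And>k x. k < D \<Longrightarrow> x \<in> {t k..<t (Suc k)} \<Longrightarrow> F x = F (t k)"
    using H_mono_pieces[OF assms(1)] by blast
  note P = partitionsD[OF Dt]
  show ?thesis
    unfolding locally_step_def
  proof (intro conjI ballI)
    fix x assume x: "x \<in> {p..<e}"
    obtain k where k: "k < D" "t k \<le> x" "x < t (Suc k)"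
      using partition_find_right[of t x D] P(2,3) x assms by auto
    have "F y = F x" if "y \<in> {x..<min e (t (Suc k))}" for y
      using F[OF k(1), of x] F[OF k(1), of y] k that by simp
    moreover have "x < min e (t (Suc k))" "min e (t (Suc k)) \<le> e" using k x by auto
    ultimately show "\<exists>r>x. r \<le> e \<and> (\<forall>y\<in>{x..<r}. F y = F x)" by blast
  next
    fix x assume x: "x \<in> {p<..e}"
    obtain k where k: "k < D" "t k < x" "x \<le> t (Suc k)"
      using partition_find_left[of t x D] P(2,3) x assms by auto
    have "F y = F (t k)" if "y \<in> {max p (t k)<..<x}" for y
      using F[OF k(1), of y] k that by simp
    moreover have "max p (t k) < x" "p \<le> max p (t k)" using k x by auto
    ultimately show "\<exists>l<x. p \<le> l \<and> (\<exists>v. \<forall>y\<in>{l<..<x}. F y = v)" by blast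
  qed
qed

lemma locally_step_uminus:
  assumes "locally_step p e F"
  shows "locally_step p e (\<lambda>x. - F x)"
  unfolding locally_step_def
proof (intro conjI ballI)
  fix x assume "x \<in> {p..<e}"
  from locally_step_right[OF assms this]
  show "\<exists>r>x. r \<le> e \<and> (\<forall>y\<in>{x..<r}. - F y = - F x)" unfolding neg_equal_iff_equal .
next
  fix x assume "x \<in> {p<..e}"
  from locally_step_left[OF assms this] obtain l v where
    "l < x" "p \<le> l" "\<forall>y\<in>{l<..<x}. F y = v" by blast
  hence "\<forall>y\<in>{l<..<x}. - F y = - v" by simp
  thus "\<exists>l<x. p \<le> l \<and> (\<exists>v. \<forall>y\<in>{l<..<x}. - F y = v)"
    using \<open>l < x\<close> \<open>p \<le> l\<close> by blast
qed

lemma dS_argmin_nonempty: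
  assumes ab: "a < b" and FH: "F \<in> H_mono a b"
  shows "dS_argmin a b F \<noteq> {}"
proof -
  have F: "mono_on {a..b} F" using FH by (simp add: H_mono_def)
  obtain D t where Dt: "(D, t) \<in> partitions a b"
    and Fk: "\<And>k x. k < D \<Longrightarrow> x \<in> {t k..<t (Suc k)} \<Longrightarrow> F x = F (t k)"
    using H_mono_pieces[OF FH] by blast
  note P = partitionsD[OF Dt]
  have tk: "t k \<in> {a..b}" if "k \<le> D" for k
    using le_of_step_le[of D t 0 k] le_of_step_le[of D t k D] P that by (auto simp: less_imp_le)
  \<comment> \<open>the infimum over the interval is attained among the finitely many jump points\<close>
  have knot: "\<exists>k\<le>D. dS a b F (t k) \<le> dS a b F m" if m: "m \<in> {a..b}" for m
  proof (cases "m = b")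
    case True
    thus ?thesis using P(3) by (intro exI[of _ D]) auto
  next
    case False
    then obtain k where k: "k < D" "t k \<le> m" "m < t (Suc k)"
      using partition_find_right[of t m D] P(2,3) m by auto
    have "dS a b F (t k) \<le> dS a b F m"
    proof (rule dS_const_piece[OF ab F])
      show "F x = F (t k)" if "x \<in> {t k..m}" for x using Fk[OF k(1), of x] that k by simp
    qed (use tk[of k] k m in auto)
    thus ?thesis using k(1) by (intro exI[of _ k]) auto
  qed
  have "Min ((\<lambda>k. dS a b F (t k)) ` {..D}) \<in> (\<lambda>k. dS a b F (t k)) ` {..D}"
    by (rule Min_in) auto
  then obtain k0 where k0: "k0 \<le> D"
    "Min ((\<lambda>k. dS a b F (t k)) ` {..D}) = dS a b F (t k0)" by (rule imageE) simp
  have "dS a b F (t k0) \<le> dS a b F m" if m: "m \<in> {a..b}" for m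
  proof -
    obtain k where k: "k \<le> D" "dS a b F (t k) \<le> dS a b F m" using knot[OF m] by blast
    have "dS a b F (t k0) \<le> dS a b F (t k)" unfolding k0(2)[symmetric] using k by (intro Min_le) auto
    thus ?thesis using k(2) by simp
  qed
  hence "t k0 \<in> dS_argmin a b F"
    using tk[OF k0(1)] unfolding dS_argmin_def is_arg_min_def by (auto simp: not_less)
  thus ?thesis by blast
qed

lemma midpoint_Inf_Sup_in:
  fixes A :: "real set"
  assumes "A \<noteq> {}" "A \<subseteq> {a..b}"
    and convex: "\<And>x y z. x \<in> A \<Longrightarrow> z \<in> A \<Longrightarrow> x \<le> y \<Longrightarrow> y \<le> z \<Longrightarrow> y \<in> A"
  shows "midpoint (Inf A) (Sup A) \<in> A"
proof -
  have bdd: "bdd_below A" "bdd_above A"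
    by (rule bdd_below_mono[OF bdd_below_Icc assms(2)], rule bdd_above_mono[OF bdd_above_Icc assms(2)])
  obtain x where x: "x \<in> A" using assms(1) by blast
  have le: "Inf A \<le> x" "x \<le> Sup A" using x bdd by (auto intro: cInf_lower cSup_upper)
  define m where "m = midpoint (Inf A) (Sup A)"
  have m: "m = (Inf A + Sup A) / 2" by (simp add: m_def midpoint_def)
  have "m \<in> A"
  proof (cases "Inf A = Sup A")
    case True
    hence "m = x" using le m by simp
    thus ?thesis using x by simp
  next
    case False
    hence "Inf A < m" "m < Sup A" using le m by auto
    then obtain y z where "y \<in> A" "y < m" "z \<in> A" "m < z"
      using cInf_lessD[OF assms(1), of m] less_cSupD[OF assms(1), of m] by blast
    thus ?thesis using convex[of y z m] by simp
  qed
  thus ?thesis by (simp add: m_def)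
qed

lemma m_hat_minimizes:
  assumes ab: "a < b" and FH: "F \<in> H_mono a b"
  shows "m_hat a b F \<in> {a..b}" and "m \<in> {a..b} \<Longrightarrow> dS a b F (m_hat a b F) \<le> dS a b F m"
proof -
  have F: "mono_on {a..b} F" using FH by (simp add: H_mono_def)
  have mem: "m \<in> dS_argmin a b F \<longleftrightarrow> m \<in> {a..b} \<and> (\<forall>m'\<in>{a..b}. dS a b F m \<le> dS a b F m')" for m
    unfolding dS_argmin_def is_arg_min_def by (auto simp: not_less)
  have "m_hat a b F \<in> dS_argmin a b F"
    unfolding m_hat_def
  proof (rule midpoint_Inf_Sup_in[OF dS_argmin_nonempty[OF ab FH]])
    show "dS_argmin a b F \<subseteq> {a..b}" using mem by blast
    fix x y z assume xyz: "x \<in> dS_argmin a b F" "z \<in> dS_argmin a b F" "x \<le> y" "y \<le> z"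
    have "dS a b F y \<le> max (dS a b F x) (dS a b F z)"
      using xyz mem by (intro dS_quasiconvex[OF ab F]) auto
    thus "y \<in> dS_argmin a b F" using xyz unfolding mem by force
  qed
  thus "m_hat a b F \<in> {a..b}" and "m \<in> {a..b} \<Longrightarrow> dS a b F (m_hat a b F) \<le> dS a b F m"
    using mem by blast+
qed

section \<open>The slope of the regularization\<close>

lemma right_slope_cong:
  assumes "right_slope p e \<Phi> k" "\<And>x. x \<in> {p..<e} \<Longrightarrow> f x = k x"
  shows "right_slope p e \<Phi> f"
  using assms unfolding right_slope_def by simp

lemma vector_derivative_right_affine:
  fixes U :: "real \<Rightarrow> real"
  assumes xr: "x < r" "r \<le> b" and aff: "\<And>y. y \<in> {x..r} \<Longrightarrow> U y = U x + k * (y - x)"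
  shows "vector_derivative U (at x within {x..b}) = k"
proof (rule vector_derivative_within_closed_interval)
  have "((\<lambda>y. U x + k * (y - x)) has_real_derivative k) (at x within {x..b})"
    by (auto intro!: derivative_eq_intros)
  hence "((\<lambda>y. U x + k * (y - x)) has_vector_derivative k) (at x within {x..b})"
    by (simp add: has_real_derivative_iff_has_vector_derivative)
  thus "(U has_vector_derivative k) (at x within {x..b})"
  proof (rule has_vector_derivative_transform_within)
    show "0 < r - x" using xr by simp
    show "U x + k * (y - x) = U y" if "y \<in> {x..b}" "dist y x < r - x" for y
      using aff[of y] that by (auto simp: dist_real_def)
  qed (use xr in auto)
qed (use xr in auto)

lemma LCM_at_max:
  assumes F: "mono_on {a..b} F" and m: "m \<in> {a..b}"
  shows "least_concave_majorant {a..m} F m = F m"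
    and "least_concave_majorant {m..b} (\<lambda>x. - F x) m = - F m"
proof (rule antisym)
  have sub: "{a..m} \<subseteq> {a..b}" "{m..b} \<subseteq> {a..b}" using m by auto
  show "least_concave_majorant {a..m} F m \<le> F m"
    by (rule LCM_le[OF concave_on_const_interval]) (use m monotone_onD[OF F, of _ m] in auto)
  show "F m \<le> least_concave_majorant {a..m} F m"
    using m by (intro LCM_ge mono_on_bdd_above(1)[OF F sub(1)]) auto
  have "least_concave_majorant {m..b} (\<lambda>x. - F x) m \<le> - F m"
    by (rule LCM_le[OF concave_on_const_interval]) (use m monotone_onD[OF F, of m] in auto)
  moreover have "- F m \<le> least_concave_majorant {m..b} (\<lambda>x. - F x) m"
    using m by (intro LCM_ge[of "\<lambda>x. - F x"] mono_on_bdd_above(2)[OF F sub(2)]) auto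
  ultimately show "least_concave_majorant {m..b} (\<lambda>x. - F x) m = - F m" by simp
qed

lemma U_slope_left:
  assumes FH: "F \<in> H_mono a b" and m: "m \<in> {a..b}"
  shows "right_slope a m (least_concave_majorant {a..m} F) (U_slope a b m F)"
proof -
  let ?L = "least_concave_majorant {a..m} F"
  have F: "mono_on {a..b} F" using FH by (simp add: H_mono_def)
  have "{a..m} \<subseteq> {a..b}" "m \<le> b" using m by auto
  then obtain k where k: "right_slope a m ?L k"
    using LCM_right_slope_exists[OF mono_on_bdd_above(1)[OF F] H_mono_locally_step[OF FH]] by blast
  show ?thesis
  proof (rule right_slope_cong[OF k])
    fix x assume x: "x \<in> {a..<m}"
    obtain r where r: "r > x" "r < m" "\<And>y. y \<in> {x..r} \<Longrightarrow> ?L y = ?L x + k x * (y - x)"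
      using right_slopeD[OF k x] by blast
    show "U_slope a b m F x = k x"
      unfolding U_slope_def
    proof (rule vector_derivative_right_affine[OF r(1)])
      show "r \<le> b" using r(2) m by simp
      show "U_regularization a b m F y = U_regularization a b m F x + k x * (y - x)"
        if "y \<in> {x..r}" for y
        using r(3)[OF that] that r(1,2) by (simp add: U_regularization_eq)
    qed
  qed
qed

lemma U_slope_right:
  assumes FH: "F \<in> H_mono a b" and m: "m \<in> {a..b}"
  shows "right_slope m b (least_concave_majorant {m..b} (\<lambda>x. - F x)) (\<lambda>x. - U_slope a b m F x)"
proof -
  let ?L = "least_concave_majorant {m..b} (\<lambda>x. - F x)"
  have F: "mono_on {a..b} F" using FH by (simp add: H_mono_def)
  have sub: "{m..b} \<subseteq> {a..b}" "a \<le> m" using m by auto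
  have U: "U_regularization a b m F y = - ?L y" if "m \<le> y" for y
    using that LCM_at_max[OF F m] by (cases "y = m") (simp_all add: U_regularization_eq)
  obtain k where k: "right_slope m b ?L k"
    using LCM_right_slope_exists[OF mono_on_bdd_above(2)[OF F sub(1)]
        locally_step_uminus[OF H_mono_locally_step[OF FH sub(2) order_refl]]] by blast
  show ?thesis
  proof (rule right_slope_cong[OF k])
    fix x assume x: "x \<in> {m..<b}"
    obtain r where r: "r > x" "r < b" "\<And>y. y \<in> {x..r} \<Longrightarrow> ?L y = ?L x + k x * (y - x)"
      using right_slopeD[OF k x] by blast
    have "U_slope a b m F x = - k x"
      unfolding U_slope_def
    proof (rule vector_derivative_right_affine[OF r(1)])
      show "r \<le> b" using r(2) by simp
      show "U_regularization a b m F y = U_regularization a b m F x + - k x * (y - x)"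
        if "y \<in> {x..r}" for y
        using r(3)[OF that] that x U[of x] U[of y] by (simp add: algebra_simps)
    qed
    thus "- U_slope a b m F x = k x" by simp
  qed
qed

section \<open>The two branches\<close>

text \<open>On \<open>{x1..x2}\<close> the two functions decrease together and the partition estimate applies with
  \<open>\<eta> = 2 * W\<close>, where \<open>W\<close> is the sum of the oscillations. On the outer intervals they are monotone
  in opposite directions; there \<open>\<Phi> - G\<close> stays within \<open>W + 2 * W\<close> of the constant \<open>\<zeta>\<close>, which gives
  \<open>4 * 3 * W\<close> for each of them that is not a single point.\<close>
lemma LCM_slope_L1_bound_reversals:
  fixes t z \<omega> \<theta> :: "nat \<Rightarrow> real" and F G f g h :: "real \<Rightarrow> real"
  assumes bdd: "bdd_above (F ` {p..e})" and step: "locally_step p e F"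
    and f: "right_slope p e (least_concave_majorant {p..e} F) f"
    and x: "p \<le> x1" "x1 \<le> x2" "x2 \<le> c" "c < e"
    and t: "\<And>k. k < n \<Longrightarrow> t k < t (Suc k)" "t 0 \<le> p" "e \<le> t n"
    and Gcont: "continuous_on {p..e} G"
    and near: "\<And>k y. k < n \<Longrightarrow> y \<in> {t k..t (Suc k)} \<Longrightarrow> y \<in> {p..e} \<Longrightarrow> \<bar>F y - G y - z k\<bar> \<le> \<omega> k"
    and z: "\<And>k. Suc k < n \<Longrightarrow> \<bar>z (Suc k) - z k\<bar> \<le> \<omega> k"
    and \<omega>: "\<And>k. k < n \<Longrightarrow> 0 \<le> \<omega> k"
    and global: "\<And>y. y \<in> {p..e} \<Longrightarrow> \<bar>F y - G y - \<zeta>\<bar> \<le> (\<Sum>k<n. \<omega> k)"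
    and \<eta>: "\<And>y. y \<in> {p..e} \<Longrightarrow> least_concave_majorant {p..e} F y - F y \<le> 2 * (\<Sum>k<n. \<omega> k)"
    and g: "mono_on {p..x1} g" "antimono_on {x1..x2} g" "mono_on {x2..c} g"
    and gabs: "g absolutely_integrable_on {p..c}"
    and G: "\<And>u v. p \<le> u \<Longrightarrow> u \<le> v \<Longrightarrow> v \<le> c \<Longrightarrow> integral {u..v} g = G v - G u"
    and h: "\<And>k y. k < n \<Longrightarrow> y \<in> {t k..<t (Suc k)} \<Longrightarrow> h y = \<theta> k"
    and int: "(\<lambda>y. \<bar>g y - h y\<bar>) integrable_on {p..c}"
  shows "integral {p..c} (\<lambda>y. \<bar>f y - g y\<bar>)
    \<le> 2 * integral {p..c} (\<lambda>y. \<bar>g y - h y\<bar>) + 10 * (\<Sum>k<n. \<omega> k)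
      + (if p < x1 then 12 * (\<Sum>k<n. \<omega> k) else 0) + (if x2 < c then 12 * (\<Sum>k<n. \<omega> k) else 0)"
proof -
  let ?L = "least_concave_majorant {p..e} F" and ?W = "\<Sum>k<n. \<omega> k"
  let ?d = "\<lambda>y. \<bar>f y - g y\<bar>"
  note slope = LCM_slope_facts[OF bdd f]
  have "antimono_on {p..c} f" using slope(1) by (rule monotone_on_subset) (use x in auto)
  from absolutely_integrable_abs_diff[OF antimono_on_absolutely_integrable[OF this] gabs]
  have dint: "?d integrable_on {p..c}" .
  have "integral {p..x1} ?d + integral {x1..c} ?d = integral {p..c} ?d"
    using x dint by (intro Henstock_Kurzweil_Integration.integral_combine) auto
  moreover have "integral {x1..x2} ?d + integral {x2..c} ?d = integral {x1..c} ?d"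
    using x integrable_on_subinterval[OF dint, of x1 c]
    by (intro Henstock_Kurzweil_Integration.integral_combine) auto
  moreover have "integral {x1..x2} ?d \<le> 2 * integral {x1..x2} (\<lambda>y. \<bar>g y - h y\<bar>) + 6 * ?W + 2 * (2 * ?W)"
  proof (rule LCM_slope_L1_bound[OF bdd step f])
    show "integral {u..v} g = G v - G u" if "x1 \<le> u" "u \<le> v" "v \<le> x2" for u v
      using G that x by auto
    show "?L y - F y \<le> 2 * ?W" if "y \<in> {x1..x2}" for y using \<eta> that x by auto
    show "(\<lambda>y. \<bar>g y - h y\<bar>) integrable_on {x1..x2}"
      by (rule integrable_on_subinterval[OF int]) (use x in auto)
    show "p \<le> x1" "x1 \<le> x2" "x2 < e" using x by auto
  qed (fact t Gcont near z \<omega> g h)+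
  moreover have "integral {x1..x2} (\<lambda>y. \<bar>g y - h y\<bar>) \<le> integral {p..c} (\<lambda>y. \<bar>g y - h y\<bar>)"
    using x int by (intro integral_subset_le integrable_on_subinterval[OF int]) auto
  moreover have opp: "integral {u..v} ?d \<le> (if u < v then 12 * ?W else 0)"
    if uv: "p \<le> u" "u \<le> v" "v \<le> c" and mono: "mono_on {u..v} g" for u v
  proof (cases "u < v")
    case True
    have "integral {u..v} ?d \<le> 4 * (3 * ?W)"
    proof (rule opposite_monotone_L1_bound[OF uv(2) _ mono])
      show "antimono_on {u..v} f" using slope(1) by (rule monotone_on_subset) (use uv x in auto)
      show "integral {r..s} f = ?L s - ?L r" if "u \<le> r" "r \<le> s" "s \<le> v" for r s
        using that uv x by (intro slope(2)) auto
      show "integral {r..s} g = G s - G r" if "u \<le> r" "r \<le> s" "s \<le> v" for r s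
        using that uv by (intro G) auto
      show "\<bar>?L y - G y - \<zeta>\<bar> \<le> 3 * ?W" if y: "y \<in> {u..v}" for y
      proof -
        have y': "y \<in> {p..e}" using y uv x by auto
        show ?thesis using \<eta>[OF y'] global[OF y'] LCM_ge[OF bdd y'] unfolding abs_le_iff by linarith
      qed
    qed
    thus ?thesis using True by simp
  qed (use uv in simp)
  have "integral {p..x1} ?d \<le> (if p < x1 then 12 * ?W else 0)"
    by (rule opp) (use x g in auto)
  moreover have "integral {x2..c} ?d \<le> (if x2 < c then 12 * ?W else 0)"
    by (rule opp) (use x g in auto)
  ultimately show ?thesis by linarith
qed

section \<open>The oracle inequality\<close>

lemma set_integrable_uminus:
  "set_integrable M A f \<Longrightarrow> set_integrable M A (\<lambda>x. - f x :: real)"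
  by (simp add: set_integrable_def)

lemma mono_on_set_integrable_lborel:
  fixes g :: "real \<Rightarrow> real"
  assumes g: "mono_on {s..t} g"
  shows "set_integrable lborel {s..t} g"
proof -
  have "(\<lambda>x. indicator {s..t} x *\<^sub>R g x) \<in> borel_measurable borel"
    using borel_measurable_mono_on_fnc[OF g] by (subst (asm) borel_measurable_restrict_space_iff) auto
  hence "(\<lambda>x. indicator {s..t} x *\<^sub>R g x) \<in> borel_measurable lborel" by simp
  from integrable_completion[OF this] show ?thesis
    using mono_on_absolutely_integrable[OF g] unfolding set_integrable_def by simp
qed

lemma U_shaped_set_integrable:
  fixes g :: "real \<Rightarrow> real"
  assumes m: "m \<in> {a..b}" and g: "antimono_on {a..m} g" "mono_on {m..b} g"
  shows "set_integrable lborel {a..b} g"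
proof -
  have "set_integrable lborel {a..m} (\<lambda>x. - (- g x))"
    using mono_on_set_integrable_lborel[OF antimono_on_uminus[OF g(1)]] 
    by (rule set_integrable_uminus)
  hence "set_integrable lborel {a..m} g" by simp
  moreover have "set_integrable lborel {m..b} g" by (rule mono_on_set_integrable_lborel[OF g(2)])
  ultimately have "set_integrable lborel ({a..m} \<union> {m..b}) g" by (rule set_integrable_Un) auto
  moreover have "{a..m} \<union> {m..b} = {a..b}" using m by auto
  ultimately show ?thesis by simp
qed

lemma set_integrable_abs_diff_step:
  fixes g h :: "real \<Rightarrow> real" and t \<theta> :: "nat \<Rightarrow> real"
  assumes g: "set_integrable lborel {t 0..t n} g"
    and t: "\<And>k. k < n \<Longrightarrow> t k \<le> t (Suc k)"
    and h: "\<And>k y. k < n \<Longrightarrow> y \<in> {t k..<t (Suc k)} \<Longrightarrow> h y = \<theta> k"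
  shows "set_integrable lborel {t 0..t n} (\<lambda>y. \<bar>g y - h y\<bar>)"
proof -
  have piece: "set_integrable lborel {t k..<t (Suc k)} (\<lambda>y. \<bar>g y - h y\<bar>)" if k: "k < n" for k
  proof -
    have "t 0 \<le> t k" "t (Suc k) \<le> t n"
      using le_of_step_le[of n t 0 k] le_of_step_le[of n t "Suc k" n] t k by auto
    hence sub: "{t k..<t (Suc k)} \<subseteq> {t 0..t n}" by auto
    have "set_integrable lborel {t k..<t (Suc k)} g"
      by (rule set_integrable_subset[OF g _ sub]) simp
    moreover have "set_integrable lborel {t k..<t (Suc k)} (\<lambda>_. \<theta> k)"
      using t[OF k] by (simp add: set_integrable_def)
    ultimately have "set_integrable lborel {t k..<t (Suc k)} (\<lambda>y. \<bar>g y - \<theta> k\<bar>)"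
      by (intro set_integrable_abs set_integral_diff(1))
    thus ?thesis
      by (rule set_integrable_cong[THEN iffD1, rotated -1]) (use h[OF k] in auto)
  qed
  have "m \<le> n \<Longrightarrow> set_integrable lborel {t 0..<t m} (\<lambda>y. \<bar>g y - h y\<bar>)" for m
  proof (induction m)
    case (Suc m)
    have "set_integrable lborel ({t 0..<t m} \<union> {t m..<t (Suc m)}) (\<lambda>y. \<bar>g y - h y\<bar>)"
      using Suc piece[of m] by (intro set_integrable_Un) auto
    moreover have "{t 0..<t m} \<union> {t m..<t (Suc m)} = {t 0..<t (Suc m)}"
      using le_of_step_le[of n t 0 m] t Suc.prems by (intro ivl_disj_un_two) auto
    ultimately show ?case by simp
  qed (simp add: set_integrable_def)
  hence "set_integrable lborel {t 0..<t n} (\<lambda>y. \<bar>g y - h y\<bar>)" by simp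
  moreover have "set_integrable lborel {t n} (\<lambda>y. \<bar>g y - h y\<bar>)"
    by (rule set_integrable_cong[THEN iffD1, OF refl refl, of _ "\<lambda>_. \<bar>g (t n) - h (t n)\<bar>"])
      (simp_all add: set_integrable_def)
  ultimately have "set_integrable lborel ({t 0..<t n} \<union> {t n}) (\<lambda>y. \<bar>g y - h y\<bar>)"
    by (rule set_integrable_Un) auto
  moreover have "{t 0..<t n} \<union> {t n} = {t 0..t n}"
    using le_of_step_le[of n t 0 n] t by (intro ivl_disj_un_singleton) auto
  ultimately show ?thesis by simp
qed

lemma integral_le_of_left_limits:
  fixes \<phi> :: "real \<Rightarrow> real"
  assumes st: "s \<le> t" and \<phi>: "\<phi> integrable_on {s..t}" and B: "0 \<le> B"
    and le: "\<And>c. s \<le> c \<Longrightarrow> c < t \<Longrightarrow> integral {s..c} \<phi> \<le> B"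
  shows "integral {s..t} \<phi> \<le> B"
proof (cases "s = t")
  case False
  hence lt: "s < t" using st by simp
  have "((\<lambda>c. integral {s..c} \<phi>) \<longlongrightarrow> integral {s..t} \<phi>) (at t within {s..t})"
    using indefinite_integral_continuous_1[OF \<phi>] st by (auto simp: continuous_on_def)
  hence "((\<lambda>c. integral {s..c} \<phi>) \<longlongrightarrow> integral {s..t} \<phi>) (at_left t)"
    by (simp only: at_within_Icc_at_left[OF lt])
  moreover have "eventually (\<lambda>c. integral {s..c} \<phi> \<le> B) (at_left t)"
    unfolding eventually_at_left_field using lt le by (intro exI[of _ s]) auto
  ultimately show ?thesis by (rule tendsto_upperbound) simp
qed (use B in simp)

text \<open>The local oscillations control \<open>Z\<close> globally, because the increments over whole pieces
  telescope.\<close>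
lemma increments_le_total:
  fixes Z :: "real \<Rightarrow> real" and t \<omega> :: "nat \<Rightarrow> real"
  assumes t: "\<And>k. k < n \<Longrightarrow> t k < t (Suc k)"
    and \<omega>: "\<And>k. k < n \<Longrightarrow> 0 \<le> \<omega> k"
    and osc: "\<And>k x. k < n \<Longrightarrow> x \<in> {t k..t (Suc k)} \<Longrightarrow> \<bar>Z x - Z (t k)\<bar> \<le> \<omega> k"
    and x: "x \<in> {t 0..t n}"
  shows "\<bar>Z x - Z (t 0)\<bar> \<le> (\<Sum>k<n. \<omega> k)"
proof -
  have knot: "m \<le> n \<Longrightarrow> \<bar>Z (t m) - Z (t 0)\<bar> \<le> (\<Sum>k<m. \<omega> k)" for m
  proof (induction m)
    case (Suc m)
    thus ?case using osc[of m "t (Suc m)"] t[of m] by simp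
  qed simp
  show ?thesis
  proof (cases "x = t n")
    case True
    thus ?thesis using knot[of n] by simp
  next
    case False
    then obtain k where k: "k < n" "t k \<le> x" "x < t (Suc k)"
      using partition_find_right[of t x n] x by auto
    have "\<bar>Z x - Z (t 0)\<bar> \<le> (\<Sum>j<Suc k. \<omega> j)" using knot[of k] osc[of k x] k by simp
    also have "\<dots> \<le> (\<Sum>j<n. \<omega> j)" using \<omega> k(1) by (intro sum_mono2) auto
    finally show ?thesis .
  qed
qed

text \<open>Both branches are treated as slopes of least concave majorants, the right one after changing
  all signs. The bounds are first proved up to a point \<open>c\<close> strictly left of the right end of the
  branch, since the majorant of \<open>- F\<close> on \<open>{M..b}\<close> may be discontinuous at \<open>b\<close>; then \<open>c\<close> tends to
  that end. Each branch costs \<open>10 * W\<close>, and the reversal between \<open>m0\<close> and \<open>M\<close>, which lies in only one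
  of them, \<open>12 * W\<close>, whence the constant \<open>32\<close>.\<close>
lemma US_L1_bound_fixed_step:
  fixes t \<theta> \<omega> :: "nat \<Rightarrow> real" and F G f g h :: "real \<Rightarrow> real"
  assumes ab: "a < b" and FH: "F \<in> H_mono a b"
    and m0: "m0 \<in> {a..b}" and g: "antimono_on {a..m0} g" "mono_on {m0..b} g"
    and G: "\<And>x. x \<in> {a..b} \<Longrightarrow> G x = integral {a..x} g"
    and Dt: "(n, t) \<in> partitions a b"
    and \<omega>: "\<And>k x. k < n \<Longrightarrow> x \<in> {t k..t (Suc k)} \<Longrightarrow> \<bar>(F x - G x) - (F (t k) - G (t k))\<bar> \<le> \<omega> k"
    and h: "\<And>k y. k < n \<Longrightarrow> y \<in> {t k..<t (Suc k)} \<Longrightarrow> h y = \<theta> k"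
  shows "L1_norm a b (\<lambda>x. US a b F x - g x) \<le> 2 * L1_norm a b (\<lambda>x. g x - h x) + 32 * (\<Sum>k<n. \<omega> k)"
proof -
  define M where "M = m_hat a b F"
  define f where "f = U_slope a b M F"
  define W where "W = (\<Sum>k<n. \<omega> k)"
  let ?gh = "\<lambda>y. \<bar>g y - h y\<bar>" and ?d = "\<lambda>y. \<bar>f y - g y\<bar>"
  have F: "mono_on {a..b} F" using FH by (simp add: H_mono_def)
  note P = partitionsD[OF Dt]
  have tk: "t k \<in> {a..b}" if "k \<le> n" for k
    using le_of_step_le[of n t 0 k] le_of_step_le[of n t k n] P that by (auto simp: less_imp_le)
  have M: "M \<in> {a..b}" and M_min: "dS a b F M \<le> dS a b F m0"
    using m_hat_minimizes[OF ab FH] m0 by (auto simp: M_def)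
  have \<omega>0: "0 \<le> \<omega> k" if "k < n" for k using \<omega>[OF that, of "t k"] P(4)[OF that] by simp
  have W0: "0 \<le> W" unfolding W_def using \<omega>0 by (intro sum_nonneg) auto

  have gset: "set_integrable lborel {a..b} g" by (rule U_shaped_set_integrable[OF m0 g])
  note gint = set_borel_integral_eq_integral(1)[OF gset]
  have gabs: "g absolutely_integrable_on {a..b}"
    using gset unfolding set_integrable_def by (rule integrable_completion[THEN iffD2, rotated])
      (use gset in \<open>simp add: set_integrable_def borel_measurable_integrable\<close>)
  have Ginc: "integral {x..y} g = G y - G x" if "a \<le> x" "x \<le> y" "y \<le> b" for x y
  proof -
    have "integral {a..x} g + integral {x..y} g = integral {a..y} g"
      using that integrable_on_subinterval[OF gint, of a y]
      by (intro Henstock_Kurzweil_Integration.integral_combine) auto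
    thus ?thesis using G[of x] G[of y] that by simp
  qed
  have Gcont: "continuous_on {a..b} G"
    using indefinite_integral_continuous_1[OF gint] by (rule continuous_on_eq) (use G in auto)
  have "set_integrable lborel {t 0..t n} ?gh"
    by (rule set_integrable_abs_diff_step) (use gset P h in \<open>auto simp: less_imp_le\<close>)
  hence ghset: "set_integrable lborel {a..b} ?gh" by (simp add: P(2,3))
  note ghint = set_borel_integral_eq_integral[OF ghset]
  have gh0: "0 \<le> integral {x..y} ?gh" if "a \<le> x" "y \<le> b" for x y
    using that
    by (intro Henstock_Kurzweil_Integration.integral_nonneg integrable_on_subinterval[OF ghint(1)]) auto

  have global: "\<bar>F y - G y - (F a - G a)\<bar> \<le> W" if "y \<in> {a..b}" for y
    unfolding W_def using increments_le_total[of n t \<omega> "\<lambda>x. F x - G x" y, OF P(4) \<omega>0 \<omega>] that P(2,3)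
    by simp
  have "dS a b F M \<le> 2 * W"
    using M_min dS_le_of_U_shaped[OF ab F m0 g Ginc global] by linarith
  hence err: "\<bar>F y - U_regularization a b M F y\<bar> \<le> 2 * W" if "y \<in> {a..b}" for y
    using U_regularization_error_le_dS[OF ab F that M] by linarith

  have left: "integral {a..c} ?d \<le> 2 * integral {a..c} ?gh + 10 * W + (if m0 < M then 12 * W else 0)"
    if c: "a \<le> c" "c < M" for c
  proof -
    define x2 where "x2 = min m0 c"
    have x2: "a \<le> x2" "x2 \<le> c" "x2 \<le> m0" "x2 < c \<Longrightarrow> x2 = m0" using c m0 by (auto simp: x2_def)
    have "integral {a..c} ?d \<le> 2 * integral {a..c} ?gh + 10 * W
        + (if a < a then 12 * W else 0) + (if x2 < c then 12 * W else 0)"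
      unfolding W_def
    proof (rule LCM_slope_L1_bound_reversals[where e = M and F = F and t = t and G = G and h = h and
          z = "\<lambda>k. F (t k) - G (t k)" and \<theta> = \<theta> and \<zeta> = "F a - G a"])
      show "bdd_above (F ` {a..M})" using M by (intro mono_on_bdd_above(1)[OF F]) auto
      show "locally_step a M F" using M by (intro H_mono_locally_step[OF FH]) auto
      show "right_slope a M (least_concave_majorant {a..M} F) f"
        unfolding f_def by (rule U_slope_left[OF FH M])
      show "continuous_on {a..M} G" using M by (intro continuous_on_subset[OF Gcont]) auto
      show "\<bar>F (t (Suc k)) - G (t (Suc k)) - (F (t k) - G (t k))\<bar> \<le> \<omega> k" if "Suc k < n" for k
        using \<omega>[of k "t (Suc k)"] P(4)[of k] that by simp
      show "\<bar>F y - G y - (F a - G a)\<bar> \<le> (\<Sum>k<n. \<omega> k)" if "y \<in> {a..M}" for y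
        using global[of y] that M by (simp add: W_def)
      show "least_concave_majorant {a..M} F y - F y \<le> 2 * (\<Sum>k<n. \<omega> k)" if "y \<in> {a..M}" for y
        using err[of y] U_regularization_error_left[OF ab F _ M, of y] that M by (simp add: W_def)
      show "mono_on {a..a} g" by (simp add: monotone_on_def)
      show "antimono_on {a..x2} g" using g(1) by (rule monotone_on_subset) (use x2 in auto)
      show "mono_on {x2..c} g"
      proof (cases "x2 < c")
        case True
        show ?thesis using g(2) by (rule monotone_on_subset) (use x2(4)[OF True] c M in auto)
      next
        case False
        hence "x2 = c" using x2 by simp
        thus ?thesis by (simp add: monotone_on_def)
      qed
      show "g absolutely_integrable_on {a..c}"
        by (rule absolutely_integrable_on_subinterval[OF gabs]) (use c M in auto)
      show "integral {u..v} g = G v - G u" if "a \<le> u" "u \<le> v" "v \<le> c" for u v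
        using Ginc[of u v] that c M by simp
      show "?gh integrable_on {a..c}"
        by (rule integrable_on_subinterval[OF ghint(1)]) (use c M in auto)
    qed (use c x2 P M \<omega> \<omega>0 h in simp_all)
    moreover have "x2 < c \<Longrightarrow> m0 < M" using x2(4) c by auto
    ultimately show ?thesis using W0 by (auto split: if_splits)
  qed
  have right: "integral {M..c} ?d \<le> 2 * integral {M..c} ?gh + 10 * W + (if M < m0 then 12 * W else 0)"
    if c: "M \<le> c" "c < b" for c
  proof -
    define x1 where "x1 = max M (min m0 c)"
    have x1: "M \<le> x1" "x1 \<le> c" "M < x1 \<Longrightarrow> x1 \<le> m0" "x1 < c \<Longrightarrow> m0 \<le> x1"
      using c by (auto simp: x1_def)
    have "integral {M..c} (\<lambda>y. \<bar>- f y - - g y\<bar>) \<le> 2 * integral {M..c} (\<lambda>y. \<bar>- g y - - h y\<bar>) + 10 * W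
        + (if M < x1 then 12 * W else 0) + (if c < c then 12 * W else 0)"
      unfolding W_def
    proof (rule LCM_slope_L1_bound_reversals[where e = b and F = "\<lambda>x. - F x" and t = t and
          G = "\<lambda>x. - G x" and h = "\<lambda>x. - h x" and z = "\<lambda>k. - (F (t k) - G (t k))" and
          \<theta> = "\<lambda>k. - \<theta> k" and \<zeta> = "- (F a - G a)"])
      show "bdd_above ((\<lambda>x. - F x) ` {M..b})" using M by (intro mono_on_bdd_above(2)[OF F]) auto
      show "locally_step M b (\<lambda>x. - F x)"
        using M by (intro locally_step_uminus H_mono_locally_step[OF FH]) auto
      show "right_slope M b (least_concave_majorant {M..b} (\<lambda>x. - F x)) (\<lambda>x. - f x)"
        unfolding f_def by (rule U_slope_right[OF FH M])
      show "continuous_on {M..b} (\<lambda>x. - G x)"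
        using M by (intro continuous_on_minus continuous_on_subset[OF Gcont]) auto
      show "\<bar>- (F (t (Suc k)) - G (t (Suc k))) - - (F (t k) - G (t k))\<bar> \<le> \<omega> k" if "Suc k < n" for k
        using \<omega>[of k "t (Suc k)"] P(4)[of k] that by (simp add: abs_le_iff)
      show "\<bar>- F y - - G y - - (F (t k) - G (t k))\<bar> \<le> \<omega> k" if "k < n" "y \<in> {t k..t (Suc k)}" for k y
        using \<omega>[OF that] by (simp add: abs_le_iff)
      show "\<bar>- F y - - G y - - (F a - G a)\<bar> \<le> (\<Sum>k<n. \<omega> k)" if "y \<in> {M..b}" for y
        using global[of y] that M by (simp add: W_def abs_le_iff)
      show "least_concave_majorant {M..b} (\<lambda>x. - F x) y - - F y \<le> 2 * (\<Sum>k<n. \<omega> k)"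
        if y: "y \<in> {M..b}" for y
      proof (cases "y = M")
        case True
        thus ?thesis using LCM_at_max(2)[OF F M] W0 by (simp add: W_def)
      next
        case False
        thus ?thesis
          using err[of y] U_regularization_error_right[OF ab F _ M, of y] y M by (simp add: W_def)
      qed
      show "mono_on {M..x1} (\<lambda>y. - g y)"
      proof (cases "M < x1")
        case True
        show ?thesis
          by (rule antimono_on_uminus, rule monotone_on_subset[OF g(1)]) (use x1(3)[OF True] M in auto)
      next
        case False
        hence "x1 = M" using x1 by simp
        thus ?thesis by (simp add: monotone_on_def)
      qed
      show "antimono_on {x1..c} (\<lambda>y. - g y)"
      proof (cases "x1 < c")
        case True
        show ?thesis
          by (rule mono_on_uminus, rule monotone_on_subset[OF g(2)]) (use x1(4)[OF True] c in auto)
      next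
        case False
        hence "x1 = c" using x1 by simp
        thus ?thesis by (simp add: monotone_on_def)
      qed
      show "mono_on {c..c} (\<lambda>y. - g y)" by (simp add: monotone_on_def)
      show "(\<lambda>y. - g y) absolutely_integrable_on {M..c}"
        by (rule set_integrable_uminus, rule absolutely_integrable_on_subinterval[OF gabs])
          (use c M in auto)
      show "integral {u..v} (\<lambda>y. - g y) = - G v - - G u" if "M \<le> u" "u \<le> v" "v \<le> c" for u v
        using Ginc[of u v] that c M by simp
      show "(\<lambda>y. \<bar>- g y - - h y\<bar>) integrable_on {M..c}"
        using integrable_on_subinterval[OF ghint(1), of M c] c M by (simp add: abs_minus_commute)
    qed (use c x1 P M \<omega>0 h in simp_all)
    moreover have "(\<lambda>y. \<bar>- f y - - g y\<bar>) = ?d" "(\<lambda>y. \<bar>- g y - - h y\<bar>) = ?gh" by auto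
    moreover have "M < x1 \<Longrightarrow> M < m0" using x1(3) by auto
    ultimately show ?thesis using W0 by (auto split: if_splits)
  qed

  show ?thesis
  proof (cases "set_integrable lborel {a..b} ?d")
    case False
    \<comment> \<open>the Lebesgue integral of a function that is not integrable is \<open>0\<close> by convention, so \<open>f\<close>
      need not be bounded near \<open>M\<close> and \<open>b\<close>\<close>
    hence "L1_norm a b (\<lambda>x. US a b F x - g x) = 0"
      unfolding L1_norm_def US_def M_def[symmetric] f_def[symmetric]
        set_lebesgue_integral_def set_integrable_def by (rule not_integrable_integral_eq)
    moreover have "0 \<le> L1_norm a b (\<lambda>x. g x - h x)"
      unfolding L1_norm_def ghint(2) by (rule gh0) simp_all
    ultimately show ?thesis using W0 by (simp add: W_def)
  next
    case True
    note dint = set_borel_integral_eq_integral[OF True]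
    have mono: "integral {x..c} ?gh \<le> integral {x..y} ?gh" if "a \<le> x" "c \<le> y" "y \<le> b" for x c y
      using that by (intro integral_subset_le integrable_on_subinterval[OF ghint(1)]) auto
    have "integral {a..M} ?d \<le> 2 * integral {a..M} ?gh + 10 * W + (if m0 < M then 12 * W else 0)"
    proof (rule integral_le_of_left_limits)
      show "?d integrable_on {a..M}"
        by (rule integrable_on_subinterval[OF dint(1)]) (use M in auto)
      show "integral {a..c} ?d \<le> 2 * integral {a..M} ?gh + 10 * W + (if m0 < M then 12 * W else 0)"
        if "a \<le> c" "c < M" for c
        using left[OF that] mono[of a c M] that M by simp
    qed (use M W0 gh0[of a M] in auto)
    moreover have "integral {M..b} ?d \<le> 2 * integral {M..b} ?gh + 10 * W + (if M < m0 then 12 * W else 0)"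
    proof (rule integral_le_of_left_limits)
      show "?d integrable_on {M..b}"
        by (rule integrable_on_subinterval[OF dint(1)]) (use M in auto)
      show "integral {M..c} ?d \<le> 2 * integral {M..b} ?gh + 10 * W + (if M < m0 then 12 * W else 0)"
        if "M \<le> c" "c < b" for c
        using right[OF that] mono[of M c b] that M by simp
    qed (use M W0 gh0[of M b] in auto)
    moreover have "integral {a..M} ?d + integral {M..b} ?d = integral {a..b} ?d"
      "integral {a..M} ?gh + integral {M..b} ?gh = integral {a..b} ?gh"
      using M dint(1) ghint(1) by (intro Henstock_Kurzweil_Integration.integral_combine; simp)+
    ultimately have "integral {a..b} ?d \<le> 2 * integral {a..b} ?gh + 32 * W"
      using W0 by (auto split: if_splits)
    thus ?thesis
      unfolding L1_norm_def US_def M_def[symmetric] f_def[symmetric] W_def[symmetric] ghint(2) dint(2) .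
  qed
qed

theorem theorem1:
  fixes a b :: real and g G F Z f :: "real \<Rightarrow> real"
  assumes "a < b"
    and "U_shaped_on a b g"
    and "\<And>t. t \<in> {a..b} \<Longrightarrow> G t = (LINT s:{a..t}|lborel. g s)"
    and "F \<in> H_mono a b"
    and "\<And>t. t \<in> {a..b} \<Longrightarrow> Z t = F t - G t"
    and "f = US a b F"
  shows "L1_norm a b (\<lambda>t. f t - g t) \<le>
    (INF (D, t) \<in> partitions a b.
       4 * L1_dist a b g (H_part a b (D, t)) +
       49 * (\<Sum>k\<in>{1..D}. SUP x\<in>{t (k - 1)..t k}. \<bar>Z x - Z (t (k - 1))\<bar>))"
proof (rule cINF_greatest)
  have trivial: "(1, \<lambda>k. if k = 0 then a else b) \<in> partitions a b"
    using assms(1) by (auto simp: partitions_def monotone_on_def)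
  thus "partitions a b \<noteq> {}" by blast
  obtain m0 where m0: "m0 \<in> {a..b}" and g: "antimono_on {a..m0} g" "mono_on {m0..b} g"
    using assms(2) unfolding U_shaped_on_def by blast
  have gset: "set_integrable lborel {a..b} g" by (rule U_shaped_set_integrable[OF m0 g])
  note gint = set_borel_integral_eq_integral(1)[OF gset]
  have G: "G x = integral {a..x} g" if "x \<in> {a..b}" for x
    using assms(3)[OF that] set_borel_integral_eq_integral(2)[OF set_integrable_subset[OF gset]] that
    by auto
  have F: "mono_on {a..b} F" using assms(4) by (simp add: H_mono_def)
  have "continuous_on {a..b} G"
    using indefinite_integral_continuous_1[OF gint] by (rule continuous_on_eq) (use G in auto)
  hence "bounded (G ` {a..b})" by (intro compact_imp_bounded compact_continuous_image) auto
  then obtain B where B: "\<And>x. x \<in> {a..b} \<Longrightarrow> \<bar>G x\<bar> \<le> B"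
    unfolding bounded_iff by force
  have Z_bound: "\<bar>Z x\<bar> \<le> \<bar>F a\<bar> + \<bar>F b\<bar> + B" if x: "x \<in> {a..b}" for x
    using monotone_onD[OF F, of a x] monotone_onD[OF F, of x b] B[OF x] x assms(5)[OF x]
    by (auto simp: abs_if split: if_splits)

  fix Dt assume Dt: "Dt \<in> partitions a b"
  obtain D t where [simp]: "Dt = (D, t)" by (cases Dt)
  note P = partitionsD[OF Dt[simplified]]
  define \<omega> where "\<omega> k = (SUP x\<in>{t k..t (Suc k)}. \<bar>Z x - Z (t k)\<bar>)" for k
  define W where "W = (\<Sum>k<D. \<omega> k)"
  have tk: "t k \<in> {a..b}" if "k \<le> D" for k
    using le_of_step_le[of D t 0 k] le_of_step_le[of D t k D] P that by (auto simp: less_imp_le)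
  have \<omega>: "\<bar>Z x - Z (t k)\<bar> \<le> \<omega> k" if k: "k < D" and x: "x \<in> {t k..t (Suc k)}" for k x
  proof -
    have "\<bar>Z y - Z (t k)\<bar> \<le> 2 * (\<bar>F a\<bar> + \<bar>F b\<bar> + B)" if "y \<in> {t k..t (Suc k)}" for y
      using Z_bound[of y] Z_bound[of "t k"] tk[of k] tk[of "Suc k"] k that by auto
    hence "bdd_above ((\<lambda>x. \<bar>Z x - Z (t k)\<bar>) ` {t k..t (Suc k)})" by (rule bdd_aboveI2)
    thus ?thesis unfolding \<omega>_def using x by (rule cSUP_upper[rotated])
  qed
  have \<omega>': "\<bar>(F x - G x) - (F (t k) - G (t k))\<bar> \<le> \<omega> k" if k: "k < D" and x: "x \<in> {t k..t (Suc k)}" for k x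
    using \<omega>[OF k x] assms(5)[of x] assms(5)[of "t k"] tk[of k] tk[of "Suc k"] k x by auto
  have W0: "0 \<le> W"
    unfolding W_def using \<omega>[of _ "t _"] P(4) by (intro sum_nonneg) (force intro: order_trans[OF abs_ge_zero])
  have "L1_norm a b (\<lambda>x. f x - g x) / 4 - 8 * W \<le> L1_dist a b g (H_part a b (D, t))"
    unfolding L1_dist_def
  proof (rule cINF_greatest)
    have "step_on a b (\<lambda>_. 0)" unfolding step_on_def using trivial by (auto simp: constant_on_def)
    hence "(\<lambda>_. 0) \<in> H_part a b (D, t)"
      by (auto simp: H_part_def cadlag_on_def constant_on_def)
    thus "H_part a b (D, t) \<noteq> {}" by blast
    fix h assume "h \<in> H_part a b (D, t)"
    hence hk: "\<forall>k\<in>{1..D}. h constant_on {t (k - 1)..<t k}" by (simp add: H_part_def)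
    have "h y = h (t k)" if k: "k < D" and y: "y \<in> {t k..<t (Suc k)}" for k y
    proof -
      have "h constant_on {t k..<t (Suc k)}" using bspec[OF hk, of "Suc k"] k by simp
      thus ?thesis using y P(4)[OF k] unfolding constant_on_def by force
    qed
    from US_L1_bound_fixed_step[OF assms(1,4) m0 g G Dt[simplified] \<omega>' this]
    have "L1_norm a b (\<lambda>x. f x - g x) \<le> 2 * L1_norm a b (\<lambda>x. g x - h x) + 32 * W"
      by (simp add: W_def assms(6))
    moreover have "0 \<le> L1_norm a b (\<lambda>x. g x - h x)"
      unfolding L1_norm_def set_lebesgue_integral_def by (intro integral_nonneg_AE) auto
    ultimately show "L1_norm a b (\<lambda>x. f x - g x) / 4 - 8 * W \<le> L1_norm a b (\<lambda>t. g t - h t)" by simp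
  qed
  moreover have "(\<Sum>k\<in>{1..D}. SUP x\<in>{t (k - 1)..t k}. \<bar>Z x - Z (t (k - 1))\<bar>) = W"
    unfolding W_def \<omega>_def by (simp add: sum.atLeast1_atMost_eq)
  ultimately show "L1_norm a b (\<lambda>t. f t - g t) \<le> (case Dt of (D, t) \<Rightarrow>
       4 * L1_dist a b g (H_part a b (D, t)) +
       49 * (\<Sum>k\<in>{1..D}. SUP x\<in>{t (k - 1)..t k}. \<bar>Z x - Z (t (k - 1))\<bar>))"
    using W0 by simp
qed

end
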